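(* Let $Z=(z_i)_{i=1}^\ell\subset\mathcal{X}$ be a fixed finite subset, $s\le\ell$, and let $Y=(y_i)_{i=1}^N$ be an $N$-point independent sample from $\mu$. Then a random convex quadrature $Q_n=\mathrm{KQuad}(k_{s,Y}^Z,Y)$ satisfies $$\mathbb{E}\left[\mathrm{wce}(Q_n;\mathcal{H}_k,\mu)\right]\le 2\int_{\mathcal{X}}\sqrt{k(x,x)-k^Z(x,x)}\,d\mu(x)+2\sqrt{\sum_{i>s}\sigma_i}+\sqrt{\frac{c_{k,\mu}}{N}},$$ where $c_{k,\mu}:=\int_{\mathcal{X}}k(x,x)\,d\mu(x)-\iint_{\mathcal{X}\times\mathcal{X}}k(x,y)\,d\mu(x)\,d\mu(y)$ and the expectation is taken regarding the draws of $Y$. The same estimate holds also for $Q_n=\mathrm{KQuad}(k_{s,\mu}^Z,Y)$.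
   Context: $\mathcal{X}$ is a Hausdorff space, $\mu$ a (Borel) probability measure on $\mathcal{X}$, and $k:\mathcal{X}\times\mathcal{X}\to\mathbb{R}$ a positive definite kernel (all Gram matrices are positive semi-definite) with $\int_{\mathcal{X}}k(x,x)\,d\mu(x)<\infty$ and reproducing kernel Hilbert space $\mathcal{H}_k$. The integral operator is $\mathcal{K}:L^2(\mu)\to L^2(\mu)$, $(\mathcal{K}f)(x)=\int_{\mathcal{X}}k(x,y)f(y)\,d\mu(y)$, with eigenpairs $(\sigma_i,e_i)_{i=1}^\infty$, $\sigma_1\ge\sigma_2\ge\cdots\ge0$, $(e_i)$ orthonormal in $L^2(\mu)$. Standing assumption: the Mercer decomposition $k(x,y)=\sum_{i=1}^\infty\sigma_i e_i(x)e_i(y)$ holds and $(\sqrt{\sigma_i}e_i)_{i}$ (over indices with $\sigma_i>0$) is an orthonormal basis of $\mathcal{H}_k$. For $Z=(z_i)_{i=1}^\ell$ write $k(Z,Z)=(k(z_i,z_j))_{i,j}$, $k(Z,x)=(k(z_i,x))_i\in\mathbb{R}^\ell$, $k(x,Z)=k(Z,x)^\top$; $A^+$ is the Moore–Penrose pseudo-inverse. $k^Z(x,y)=k(x,Z)k(Z,Z)^+k(Z,y)$. Truncated kernels: for a probability measure $\nu$ (either $\nu=\mu$ or the empirical measure $\nu=\mu_Y=\frac1N\sum_{j=1}^N\delta_{y_j}$), let $h_\nu(x,y)=\int k(x,t)k(t,y)\,d\nu(t)$ and $h_\nu(Z,Z)=(h_\nu(z_i,z_j))_{i,j}$; take $H\in\mathbb{R}^{\ell\times\ell}$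 with $H^\top H=h_\nu(Z,Z)$, decompose $Hk(Z,Z)^+H^\top=V\mathrm{diag}(\kappa_1,\dots,\kappa_\ell)V^\top$ with $V=[v_1,\dots,v_\ell]$ orthogonal, $\kappa_1\ge\cdots\ge\kappa_\ell\ge0$, put $f_i(x)=(H^+v_i)^\top k(Z,x)$, and define $k_{s,\nu}^Z(x,y)=\sum_{i=1}^s\kappa_if_i(x)f_i(y)$. Then $k_{s,\mu}^Z$ is the case $\nu=\mu$ and $k_{s,Y}^Z$ is the case $\nu=\mu_Y$. Quadrature: an $n$-point quadrature rule is $Q_n:f\mapsto\sum_{i=1}^nw_if(x_i)$; it is convex if $w_i\ge0$ and $\sum_iw_i=1$. $\mathrm{wce}(Q_n;\mathcal{H}_k,\mu)=\sup_{\lVert f\rVert_{\mathcal{H}_k}\le1}|Q_n(f)-\int f\,d\mu|$. For an $s$-rank kernel $k_{\mathrm{app}}(x,y)=\sum_{i=1}^sc_i\varphi_i(x)\varphi_i(y)$ with $c_i\ge0$ (for the kernels above, $c_i=\kappa_i$, $\varphi_i=f_i$), $Q_n=\mathrm{KQuad}(k_{\mathrm{app}},Y)$ means that $Q_n$ is a convex quadrature with $n=s+1$ points, which are taken from $Y$, satisfying $$Q_n(\varphi_i)=\mu_Y(\varphi_i)\ (1\le i\le s),\qquad Q_n\left(\sqrt{k-k_{\mathrm{app}}}\right)\le\mu_Y\left(\sqrt{k-k_{\mathrm{app}}}\right),$$ where $\mu_Y(f)=\frac1N\sum_jf(y_j)$ and $\sqrt{k-k_{\mathrm{app}}}$ denotes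 the function $x\mapsto\sqrt{k(x,x)-k_{\mathrm{app}}(x,x)}$. *)

theory Defs
  imports "HOL-Probability.Probability"
begin

section \<open>Positive definite kernels and their reproducing kernel Hilbert spaces\<close>

definition pd_kernel :: "('a \<Rightarrow> 'a \<Rightarrow> real) \<Rightarrow> bool" where
  "pd_kernel k \<longleftrightarrow>
     (\<forall>x y. k x y = k y x) \<and>
     (\<forall>(n::nat) (x :: nat \<Rightarrow> 'a) (c :: nat \<Rightarrow> real).
        0 \<le> (\<Sum>i<n. \<Sum>j<n. c i * c j * k (x i) (x j)))"

definition ip_norm :: "(('a \<Rightarrow> real) \<Rightarrow> ('a \<Rightarrow> real) \<Rightarrow> real) \<Rightarrow> ('a \<Rightarrow> real) \<Rightarrow> real" where
  "ip_norm ip f = sqrt (ip f f)"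

text \<open>The space is a set \<open>H\<close> of genuine functions (not of equivalence classes)
  with inner product \<open>ip\<close>; values of \<open>ip\<close> outside \<open>H\<close> are irrelevant.  By the
  Moore--Aronszajn theorem \<open>H\<close>, and \<open>ip\<close> on \<open>H\<close>, are determined by \<open>k\<close>.\<close>

locale rkhs =
  fixes k :: "'a \<Rightarrow> 'a \<Rightarrow> real"
    and H :: "('a \<Rightarrow> real) set"
    and ip :: "('a \<Rightarrow> real) \<Rightarrow> ('a \<Rightarrow> real) \<Rightarrow> real"
  assumes zero_mem: "(\<lambda>x. 0) \<in> H"
    and add_mem: "\<lbrakk>f \<in> H; g \<in> H\<rbrakk> \<Longrightarrow> (\<lambda>x. f x + g x) \<in> H"
    and scale_mem: "f \<in> H \<Longrightarrow> (\<lambda>x. c * f x) \<in> H"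
    and ip_commute: "\<lbrakk>f \<in> H; g \<in> H\<rbrakk> \<Longrightarrow> ip f g = ip g f"
    and ip_add: "\<lbrakk>f \<in> H; g \<in> H; h \<in> H\<rbrakk> \<Longrightarrow> ip (\<lambda>x. f x + g x) h = ip f h + ip g h"
    and ip_scale: "\<lbrakk>f \<in> H; g \<in> H\<rbrakk> \<Longrightarrow> ip (\<lambda>x. c * f x) g = c * ip f g"
    and ip_nonneg: "f \<in> H \<Longrightarrow> 0 \<le> ip f f"
    and ip_definite: "\<lbrakk>f \<in> H; ip f f = 0\<rbrakk> \<Longrightarrow> f = (\<lambda>x. 0)"
    and complete: "Metric_space.mcomplete H (\<lambda>f g. ip_norm ip (\<lambda>x. f x - g x))"
    and section_mem: "k x \<in> H"
    and reproducing: "f \<in> H \<Longrightarrow> ip f (k x) = f x"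

definition orthonormal_basis ::
    "('a \<Rightarrow> real) set \<Rightarrow> (('a \<Rightarrow> real) \<Rightarrow> ('a \<Rightarrow> real) \<Rightarrow> real) \<Rightarrow> 'i set \<Rightarrow> ('i \<Rightarrow> 'a \<Rightarrow> real) \<Rightarrow> bool"
  where
  "orthonormal_basis H ip I b \<longleftrightarrow>
     (\<forall>i\<in>I. b i \<in> H) \<and>
     (\<forall>i\<in>I. \<forall>j\<in>I. ip (b i) (b j) = (if i = j then 1 else 0)) \<and>
     (\<forall>f\<in>H. \<forall>\<epsilon>>0. \<exists>F c. finite F \<and> F \<subseteq> I \<and>
        ip_norm ip (\<lambda>x. f x - (\<Sum>i\<in>F. c i * b i x)) < \<epsilon>)"


section \<open>Integral operator and Mercer decomposition\<close>

definition int_op :: "('a \<Rightarrow> 'a \<Rightarrow> real) \<Rightarrow> 'a measure \<Rightarrow> ('a \<Rightarrow> real) \<Rightarrow> 'a \<Rightarrow> real" where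
  "int_op k \<mu> f x = (\<integral>y. k x y * f y \<partial>\<mu>)"

definition L2_orthonormal :: "'a measure \<Rightarrow> (nat \<Rightarrow> 'a \<Rightarrow> real) \<Rightarrow> bool" where
  "L2_orthonormal \<mu> e \<longleftrightarrow>
     (\<forall>i. e i \<in> borel_measurable \<mu> \<and> integrable \<mu> (\<lambda>x. (e i x)\<^sup>2)) \<and>
     (\<forall>i j. (\<integral>x. e i x * e j x \<partial>\<mu>) = (if i = j then 1 else 0))"

text \<open>Indices start at 0: \<open>(\<sigma> i, e i)\<close> is the \<open>(i+1)\<close>-st eigenpair.\<close>

definition eigen_system ::
    "('a \<Rightarrow> 'a \<Rightarrow> real) \<Rightarrow> 'a measure \<Rightarrow> (nat \<Rightarrow> real) \<Rightarrow> (nat \<Rightarrow> 'a \<Rightarrow> real) \<Rightarrow> bool" where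
  "eigen_system k \<mu> \<sigma> e \<longleftrightarrow>
     L2_orthonormal \<mu> e \<and> decseq \<sigma> \<and> (\<forall>i. 0 \<le> \<sigma> i) \<and>
     (\<forall>i. AE x in \<mu>. int_op k \<mu> (e i) x = \<sigma> i * e i x)"

definition mercer_decomposition ::
    "('a \<Rightarrow> 'a \<Rightarrow> real) \<Rightarrow> (nat \<Rightarrow> real) \<Rightarrow> (nat \<Rightarrow> 'a \<Rightarrow> real) \<Rightarrow> bool" where
  "mercer_decomposition k \<sigma> e \<longleftrightarrow> (\<forall>x y. (\<lambda>i. \<sigma> i * e i x * e i y) sums k x y)"


section \<open>Low-rank kernels\<close>

definition moore_penrose :: "real^'n^'m \<Rightarrow> real^'m^'n \<Rightarrow> bool" where
  "moore_penrose A B \<longleftrightarrow>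
     A ** B ** A = A \<and> B ** A ** B = B \<and>
     transpose (A ** B) = A ** B \<and> transpose (B ** A) = B ** A"

definition pinv :: "real^'n^'m \<Rightarrow> real^'m^'n" where
  "pinv A = (THE B. moore_penrose A B)"

definition gram :: "('a \<Rightarrow> 'a \<Rightarrow> real) \<Rightarrow> ('l::finite \<Rightarrow> 'a) \<Rightarrow> real^'l::_^'l::_" where
  "gram k Z = (\<chi> i j. k (Z i) (Z j))"

definition kvec :: "('a \<Rightarrow> 'a \<Rightarrow> real) \<Rightarrow> ('l::finite \<Rightarrow> 'a) \<Rightarrow> 'a \<Rightarrow> real^'l::_" where
  "kvec k Z x = (\<chi> i. k (Z i) x)"

definition nystrom :: "('a \<Rightarrow> 'a \<Rightarrow> real) \<Rightarrow> ('l::finite \<Rightarrow> 'a) \<Rightarrow> 'a \<Rightarrow> 'a \<Rightarrow> real" where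
  "nystrom k Z x y = kvec k Z x \<bullet> (pinv (gram k Z) *v kvec k Z y)"

definition empirical_measure :: "nat \<Rightarrow> (nat \<Rightarrow> 'a::topological_space) \<Rightarrow> 'a measure" where
  "empirical_measure N y = distr (uniform_count_measure {..<N}) borel y"

definition h_kernel :: "('a \<Rightarrow> 'a \<Rightarrow> real) \<Rightarrow> 'a measure \<Rightarrow> 'a \<Rightarrow> 'a \<Rightarrow> real" where
  "h_kernel k \<nu> x y = (\<integral>t. k x t * k t y \<partial>\<nu>)"

definition diag_mat :: "real^'l \<Rightarrow> real^'l^'l" where
  "diag_mat d = (\<chi> i j. if i = j then d $ i else 0)"

text \<open>Neither the factor \<open>A\<close> (with \<open>A\<^sup>T A = h\<^sub>\<nu>(Z,Z)\<close>) nor the spectral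
  decomposition is unique, so admissible choices are described by a predicate.
  The linear order of the index type is the order of the eigenvalues.\<close>

definition trunc_decomp ::
    "('a \<Rightarrow> 'a \<Rightarrow> real) \<Rightarrow> 'a measure \<Rightarrow> ('l::{finite,linorder} \<Rightarrow> 'a) \<Rightarrow>
     real^'l::_^'l::_ \<Rightarrow> real^'l::_^'l::_ \<Rightarrow> real^'l::_ \<Rightarrow> bool" where
  "trunc_decomp k \<nu> Z A V \<kappa> \<longleftrightarrow>
     transpose A ** A = gram (h_kernel k \<nu>) Z \<and>
     orthogonal_matrix V \<and>
     A ** pinv (gram k Z) ** transpose A = V ** diag_mat \<kappa> ** transpose V \<and>
     (\<forall>i j. i \<le> j \<longrightarrow> \<kappa> $ j \<le> \<kappa> $ i) \<and> (\<forall>i. 0 \<le> \<kappa> $ i)"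

text \<open>\<open>ix i\<close>, for \<open>i < CARD('l)\<close>, is the \<open>(i+1)\<close>-st smallest element of the index type.\<close>

definition ix :: "nat \<Rightarrow> 'l::{finite,linorder}" where
  "ix i = sorted_list_of_set UNIV ! i"

definition trunc_fun ::
    "('a \<Rightarrow> 'a \<Rightarrow> real) \<Rightarrow> ('l::{finite,linorder} \<Rightarrow> 'a) \<Rightarrow> real^'l::_^'l::_ \<Rightarrow> real^'l::_^'l::_ \<Rightarrow>
     nat \<Rightarrow> 'a \<Rightarrow> real" where
  "trunc_fun k Z A V i x = (pinv A *v column (ix i) V) \<bullet> kvec k Z x"

definition finite_rank_kernel ::
    "nat \<Rightarrow> (nat \<Rightarrow> real) \<Rightarrow> (nat \<Rightarrow> 'a \<Rightarrow> real) \<Rightarrow> 'a \<Rightarrow> 'a \<Rightarrow> real" where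
  "finite_rank_kernel s c \<phi> x y = (\<Sum>i<s. c i * \<phi> i x * \<phi> i y)"


section \<open>Quadrature\<close>

definition quad :: "nat \<Rightarrow> (nat \<Rightarrow> real) \<Rightarrow> (nat \<Rightarrow> 'a) \<Rightarrow> ('a \<Rightarrow> real) \<Rightarrow> real" where
  "quad n w x f = (\<Sum>i<n. w i * f (x i))"

definition convex_weights :: "nat \<Rightarrow> (nat \<Rightarrow> real) \<Rightarrow> bool" where
  "convex_weights n w \<longleftrightarrow> (\<forall>i<n. 0 \<le> w i) \<and> (\<Sum>i<n. w i) = 1"

definition emp_mean :: "nat \<Rightarrow> (nat \<Rightarrow> 'a) \<Rightarrow> ('a \<Rightarrow> real) \<Rightarrow> real" where
  "emp_mean N y f = (\<Sum>j<N. f (y j)) / real N"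

text \<open>Extended-valued, so that the supremum is meaningful without a boundedness side condition.\<close>

definition wce ::
    "('a \<Rightarrow> real) set \<Rightarrow> (('a \<Rightarrow> real) \<Rightarrow> ('a \<Rightarrow> real) \<Rightarrow> real) \<Rightarrow> 'a measure \<Rightarrow>
     nat \<Rightarrow> (nat \<Rightarrow> real) \<Rightarrow> (nat \<Rightarrow> 'a) \<Rightarrow> ennreal" where
  "wce H ip \<mu> n w x =
     (SUP f\<in>{f \<in> H. ip_norm ip f \<le> 1}. ennreal \<bar>quad n w x f - (\<integral>t. f t \<partial>\<mu>)\<bar>)"

definition KQuad ::
    "('a \<Rightarrow> 'a \<Rightarrow> real) \<Rightarrow> nat \<Rightarrow> (nat \<Rightarrow> real) \<Rightarrow> (nat \<Rightarrow> 'a \<Rightarrow> real) \<Rightarrow>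
     nat \<Rightarrow> (nat \<Rightarrow> 'a) \<Rightarrow> (nat \<Rightarrow> real) \<Rightarrow> (nat \<Rightarrow> 'a) \<Rightarrow> bool" where
  "KQuad k s c \<phi> N y w x \<longleftrightarrow>
     convex_weights (s + 1) w \<and>
     (\<forall>i<s + 1. x i \<in> y ` {..<N}) \<and>
     (\<forall>i<s. quad (s + 1) w x (\<phi> i) = emp_mean N y (\<phi> i)) \<and>
     (let g = (\<lambda>t. sqrt (k t t - finite_rank_kernel s c \<phi> t t))
      in quad (s + 1) w x g \<le> emp_mean N y g)"

definition kernel_const :: "('a \<Rightarrow> 'a \<Rightarrow> real) \<Rightarrow> 'a measure \<Rightarrow> real" where
  "kernel_const k \<mu> = (\<integral>x. k x x \<partial>\<mu>) - (\<integral>x. (\<integral>y. k x y \<partial>\<mu>) \<partial>\<mu>)"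

end

(*
On the sample points the worst-case error of Q_n splits into |Q_n(f) - mu_Y(f)| and
|mu_Y(f) - mu(f)|.

First part.  Write H^T H = h_nu(Z,Z) as in the definition of the truncated kernel (this matrix is
the A of trunc_decomp).  For
nu-almost every t the vector k(Z,t) lies in the row space of H.  At such "good" points the
functions sqrt(kappa_i) f_i agree with an orthonormal system u_i of the RKHS, although as
functions on the whole space they need not; this is all that is required, since the nodes and
the sample are almost surely good.  Subtracting from f its projection onto u_1, ..., u_s does not
change Q_n(f) - mu_Y(f), and the remainder at t is at most sqrt(k(t,t) - k_s(t,t)), which
yields 2 mu_Y(sqrt(k - k_s)).  There k^Z - k_s = sum_{i>s} kappa_i f_i^2 has nu-integral at
most sum_{i>s} kappa_i, and the Eckart-Young inequality bounds this by the nu-integral of the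
Mercer tail sum_{i>s} sigma_i e_i(t)^2: compare the kappa_i-weighted orthogonal system u_i
in L^2(nu) with its approximation from the span of e_1, ..., e_s.  Taking expectations and using
Jensen's inequality gives sqrt(sum_{i>s} sigma_i) for both choices of nu.

Second part.  Expanding f in the basis sqrt(sigma_i) e_i, the error is at most the square root
of sum_i sigma_i (mu_Y(e_i) - mu(e_i))^2, whose expectation is c_{k,mu} / N.
*)
theory Submission
  imports Defs
begin

section \<open>Matrices\<close>

lemma matrix_vector_inner: "(A *v x) \<bullet> y = x \<bullet> (transpose A *v y)" for A :: "real^'n^'m"
  by (metis dot_lmul_matrix inner_commute transpose_matrix_vector)

text \<open>Projecting \<open>b\<close> onto the range of \<open>A\<close> leaves a residual
  orthogonal to that range, hence killed by \<open>transpose A\<close>; so A^T A x = A^T b is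
  solvable for every \<open>b\<close>. Solutions for the standard basis vectors form the columns of
  \<open>X\<close>.\<close>

lemma normal_equations_solvable:
  fixes A :: "real^'n^'m"
  obtains X where "transpose A ** A ** X = transpose A"
proof -
  have "\<exists>x. transpose A *v (A *v x) = transpose A *v b" for b
  proof -
    obtain y z where y: "y \<in> span (range ((*v) A))"
      and z: "\<And>w. w \<in> span (range ((*v) A)) \<Longrightarrow> orthogonal z w" and b: "b = y + z"
      using orthogonal_subspace_decomp_exists[of "range ((*v) A)" b] by blast
    have "span (range ((*v) A)) = range ((*v) A)"
      by (simp add: linear_subspace_image span_eq_iff[THEN iffD2])
    with y have "y \<in> range ((*v) A)" by metis
    then obtain x where x: "y = A *v x" by blast
    have "(transpose A *v z) \<bullet> w = 0" for w
      using z[of "A *v w"] by (simp add: matrix_vector_inner orthogonal_def span_base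
          del: transpose_matrix_vector)
    then have "transpose A *v z = 0"
      using inner_eq_zero_iff by blast
    then show ?thesis
      by (metis b x add.right_neutral matrix_vector_right_distrib)
  qed
  then obtain g where g: "\<And>b. transpose A *v (A *v g b) = transpose A *v b" by metis
  define X :: "real^'m^'n" where "X = (\<chi> i j. g (axis j 1) $ i)"
  have "(transpose A ** A ** X) *v axis j 1 = transpose A *v axis j 1" for j
  proof -
    have "X *v axis j 1 = g (axis j 1)"
      by (simp add: X_def vec_eq_iff matrix_vector_mul_component inner_axis)
    then show ?thesis
      using g by (simp add: matrix_vector_mul_assoc[symmetric] del: transpose_matrix_vector)
  qed
  then have "transpose A ** A ** X = transpose A"
    by (simp add: matrix_vector_mult_basis column_def vec_eq_iff del: transpose_matrix_vector)
  then show ?thesis by (rule that)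
qed

lemma transpose_mult_self_eq_0: "transpose A ** A = 0 \<Longrightarrow> A = 0" for A :: "real^'n^'m"
proof -
  assume "transpose A ** A = 0"
  then have "(A *v x) \<bullet> (A *v x) = 0" for x
    by (simp add: matrix_vector_inner matrix_vector_mul_assoc del: transpose_matrix_vector)
  then show "A = 0" by (simp add: matrix_eq)
qed

lemma matrix_diff_ldistrib: "A ** (B - C) = A ** B - A ** C" for A :: "real^'n^'m"
  by (simp add: matrix_eq matrix_vector_mul_assoc[symmetric] matrix_vector_mult_diff_rdistrib
      matrix_vector_mult_diff_distrib)

text \<open>Multiplying A^T A X = A^T by X^T shows that (AX)^T is the Gram matrix (AX)^T (AX), hence
  symmetric. For the other equation, B = A(XA - 1) satisfies A^T B = 0, so B^T B = 0 and B
  vanishes.\<close>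

lemma ex_13_inverse:
  fixes A :: "real^'n^'m"
  obtains X where "A ** X ** A = A" "transpose (A ** X) = A ** X"
proof -
  obtain X where X: "transpose A ** A ** X = transpose A"
    using normal_equations_solvable by blast
  have "transpose (A ** X) ** (A ** X) = transpose (A ** X)"
    using X by (metis matrix_mul_assoc matrix_transpose_mul)
  then have sym: "transpose (A ** X) = A ** X"
    by (metis matrix_transpose_mul transpose_transpose)
  have "transpose A ** (A ** X ** A - A) = 0"
    using X by (simp add: matrix_diff_ldistrib matrix_mul_assoc)
  then have "transpose A ** (A ** (X ** A - mat 1)) = 0"
    by (simp add: matrix_diff_ldistrib matrix_mul_assoc)
  then have "transpose (A ** (X ** A - mat 1)) ** (A ** (X ** A - mat 1)) = 0"
    unfolding matrix_transpose_mul matrix_mul_assoc[symmetric] by simp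
  then have "A ** (X ** A - mat 1) = 0" by (rule transpose_mult_self_eq_0)
  then have "A ** X ** A = A"
    by (simp add: matrix_diff_ldistrib matrix_mul_assoc)
  with sym show ?thesis using that by blast
qed

text \<open>\<open>A ** B\<close> and \<open>A ** C\<close> are both the orthogonal projection onto
  the range of \<open>A\<close>, and \<open>B ** A\<close> and \<open>C ** A\<close> both that onto
  its row space. Hence B = BAB = BAC = CAC = C.\<close>

lemma moore_penrose_unique:
  assumes "moore_penrose A B" "moore_penrose A C"
  shows "B = C"
proof -
  from assms have b: "A ** B ** A = A" "B ** A ** B = B" "transpose (A ** B) = A ** B"
      "transpose (B ** A) = B ** A"
    and c: "A ** C ** A = A" "C ** A ** C = C" "transpose (A ** C) = A ** C"
      "transpose (C ** A) = C ** A"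
    by (simp_all add: moore_penrose_def)
  have "A ** B = A ** C ** (A ** B)" using c by (metis matrix_mul_assoc)
  then have "A ** B = A ** B ** (A ** C)" using b c by (metis matrix_transpose_mul)
  then have 1: "A ** B = A ** C" using b by (metis matrix_mul_assoc)
  have "B ** A = B ** A ** (C ** A)" using c by (metis matrix_mul_assoc)
  then have "B ** A = C ** A ** (B ** A)" using b c by (metis matrix_transpose_mul)
  then have 2: "B ** A = C ** A" using b by (metis matrix_mul_assoc)
  show ?thesis using 1 2 b c by (metis matrix_mul_assoc)
qed

lemma moore_penrose_pinv: "moore_penrose A (pinv A)"
proof -
  obtain X where X: "A ** X ** A = A" "transpose (A ** X) = A ** X"
    by (rule ex_13_inverse)
  \<comment> \<open>The transpose of a {1,3}-inverse of \<open>transpose A\<close> is a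
    {1,4}-inverse of \<open>A\<close>.\<close>
  obtain Y' where Y': "transpose A ** Y' ** transpose A = transpose A"
      "transpose (transpose A ** Y') = transpose A ** Y'"
    by (rule ex_13_inverse)
  define Y where "Y = transpose Y'"
  have Y: "A ** Y ** A = A" "transpose (Y ** A) = Y ** A"
    using Y' unfolding Y_def
    by (metis matrix_mul_assoc matrix_transpose_mul transpose_transpose)+
  \<comment> \<open>Urquhart's formula: a \<open>{1,4}\<close>-inverse times \<open>A\<close> times a \<open>{1,3}\<close>-inverse.\<close>
  have "moore_penrose A (Y ** A ** X)"
  proof -
    have "A ** (Y ** A ** X) = A ** X" using Y by (metis matrix_mul_assoc)
    moreover have "(Y ** A ** X) ** A = Y ** A" using X by (metis matrix_mul_assoc)
    ultimately show ?thesis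
      unfolding moore_penrose_def using X Y by (metis matrix_mul_assoc)
  qed
  then show ?thesis
    unfolding pinv_def by (rule theI) (rule moore_penrose_unique[OF _ \<open>moore_penrose A (Y ** A ** X)\<close>])
qed

lemma pinv_props:
  shows pinv_1: "A ** pinv A ** A = A" and pinv_2: "pinv A ** A ** pinv A = pinv A"
    and pinv_3: "transpose (A ** pinv A) = A ** pinv A"
    and pinv_4: "transpose (pinv A ** A) = pinv A ** A"
  using moore_penrose_pinv[of A] by (simp_all add: moore_penrose_def)

lemma pinv_symmetric:
  assumes "transpose A = A"
  shows "transpose (pinv A) = pinv A"
proof -
  have "moore_penrose A (transpose (pinv A))"
    unfolding moore_penrose_def
    by (metis assms matrix_mul_assoc matrix_transpose_mul pinv_props transpose_transpose)
  then show ?thesis by (rule moore_penrose_unique[OF _ moore_penrose_pinv])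
qed

text \<open>P = \<open>A ** pinv A\<close> is symmetric and idempotent, so |Px|^2 = x . Px, and
  Cauchy-Schwarz applies.\<close>

lemma range_projection_contraction: "norm (A ** pinv A *v x) \<le> norm x"
proof -
  let ?P = "A ** pinv A"
  have "(norm (?P *v x))\<^sup>2 = x \<bullet> (?P *v x)"
    unfolding power2_norm_eq_inner matrix_vector_inner pinv_3
    by (simp add: matrix_vector_mul_assoc matrix_mul_assoc pinv_1)
  also have "\<dots> \<le> norm x * norm (?P *v x)" by (rule norm_cauchy_schwarz)
  finally show ?thesis
    by (metis mult_right_le_imp_le norm_ge_zero norm_zero order_le_less power2_eq_square)
qed

section \<open>The Eckart-Young inequality for a diagonal matrix\<close>

lemma Bessel_orthonormal_set:
  fixes x :: "'a::real_inner"
  assumes "finite B" "pairwise orthogonal B" "\<And>b. b \<in> B \<Longrightarrow> norm b = 1"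
  shows "(\<Sum>b\<in>B. (b \<bullet> x)\<^sup>2) \<le> (norm x)\<^sup>2"
proof -
  let ?y = "\<Sum>b\<in>B. (b \<bullet> x) *\<^sub>R b"
  have y: "(norm ?y)\<^sup>2 = (\<Sum>b\<in>B. (b \<bullet> x)\<^sup>2)"
    using assms by (subst norm_sum_Pythagorean)
      (auto simp: pairwise_def orthogonal_def power_mult_distrib)
  have "x \<bullet> ?y = (\<Sum>b\<in>B. (b \<bullet> x)\<^sup>2)"
    by (simp add: inner_sum_right power2_eq_square inner_commute)
  then have "0 \<le> (norm x)\<^sup>2 - (\<Sum>b\<in>B. (b \<bullet> x)\<^sup>2)"
    using y zero_le_power2[of "norm (x - ?y)"]
    by (simp add: power2_norm_eq_inner inner_diff_left inner_diff_right inner_commute)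
  then show ?thesis by simp
qed

text \<open>An exchange argument. Weight missing on the complement of \<open>S\<close> saves at most
  \<open>c\<close> per unit, and the lower bound on the total weight forces at least as much weight
  onto \<open>S\<close>, where each unit is worth at least \<open>c\<close>.\<close>

lemma sum_complement_le_weighted_sum:
  fixes \<kappa> \<tau> :: "'i::finite \<Rightarrow> real"
  assumes "0 \<le> c" "\<And>i. i \<in> S \<Longrightarrow> c \<le> \<kappa> i" "\<And>i. i \<notin> S \<Longrightarrow> \<kappa> i \<le> c"
    and "\<And>i. 0 \<le> \<tau> i" "\<And>i. \<tau> i \<le> 1" and "real (card (- S)) \<le> (\<Sum>i\<in>UNIV. \<tau> i)"
  shows "(\<Sum>i\<in>- S. \<kappa> i) \<le> (\<Sum>i\<in>UNIV. \<kappa> i * \<tau> i)"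
proof -
  have split: "(\<Sum>i\<in>UNIV. g i) = (\<Sum>i\<in>S. g i) + (\<Sum>i\<in>- S. g i)" for g :: "'i \<Rightarrow> real"
    by (metis Compl_partition Compl_disjoint finite sum.union_disjoint)
  have "(\<Sum>i\<in>- S. \<kappa> i) - (\<Sum>i\<in>- S. \<kappa> i * \<tau> i) = (\<Sum>i\<in>- S. \<kappa> i * (1 - \<tau> i))"
    by (simp add: algebra_simps sum_subtractf)
  also have "\<dots> \<le> (\<Sum>i\<in>- S. c * (1 - \<tau> i))"
    using assms by (intro sum_mono mult_right_mono) auto
  also have "\<dots> = c * (real (card (- S)) - (\<Sum>i\<in>- S. \<tau> i))"
    by (simp add: sum_distrib_left[symmetric] sum_subtractf)
  also have "\<dots> \<le> c * (\<Sum>i\<in>S. \<tau> i)"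
    using assms(1,6) split[of \<tau>] by (intro mult_left_mono) auto
  also have "\<dots> \<le> (\<Sum>i\<in>S. \<kappa> i * \<tau> i)"
    unfolding sum_distrib_left using assms by (intro sum_mono mult_right_mono) auto
  finally show ?thesis using split[of "\<lambda>i. \<kappa> i * \<tau> i"] by simp
qed

text \<open>The columns of diag(sqrt kappa) are approximated by combinations of \<open>s\<close>
  vectors \<open>p j\<close>. Testing the errors against an orthonormal basis \<open>B\<close> of
  the complement of the \<open>p j\<close> removes the approximants and leaves
  \<open>\<kappa> $ i * \<tau> i\<close>. As \<open>B\<close> has at least CARD('l) - s elements,
  the exchange argument applies to the weights \<open>\<tau>\<close>.\<close>

lemma Eckart_Young_diagonal:
  fixes \<kappa> :: "real^'l" and p :: "nat \<Rightarrow> real^'l"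
  assumes \<kappa>: "\<And>i. 0 \<le> \<kappa> $ i" and "0 \<le> c"
    and S: "\<And>i. i \<in> S \<Longrightarrow> c \<le> \<kappa> $ i" "\<And>i. i \<notin> S \<Longrightarrow> \<kappa> $ i \<le> c" and card: "card S = s"
  shows "(\<Sum>i\<in>- S. \<kappa> $ i)
    \<le> (\<Sum>i\<in>UNIV. (norm (sqrt (\<kappa> $ i) *\<^sub>R axis i 1 - (\<Sum>j<s. a i j *\<^sub>R p j)))\<^sup>2)"
proof -
  define W where "W = {q. \<forall>x\<in>span (p ` {..<s}). orthogonal x q}"
  have dimW: "dim W + dim (span (p ` {..<s})) = CARD('l)"
    using dim_subspace_orthogonal_to_vectors[of "span (p ` {..<s})" "UNIV :: (real^'l) set"]
    by (simp add: W_def)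
  have "dim (span (p ` {..<s})) \<le> s"
    by (metis card_image_le card_lessThan dim_le_card dim_span finite_imageI finite_lessThan
        le_trans order_refl span_superset)
  with dimW have dimW: "CARD('l) - s \<le> dim W" by simp
  have "subspace W"
    by (auto simp: W_def subspace_def orthogonal_def inner_right_distrib)
  then obtain B where B: "B \<subseteq> W" "pairwise orthogonal B" "\<And>x. x \<in> B \<Longrightarrow> norm x = 1"
    and ind: "independent B" "card B = dim W"
    using orthonormal_basis_subspace by blast
  have fin: "finite B" using ind(1) by (rule independent_imp_finite)
  define \<tau> where "\<tau> i = (\<Sum>q\<in>B. (q $ i)\<^sup>2)" for i
  have orth: "q \<bullet> p j = 0" if "q \<in> B" "j < s" for q j
    using B(1) that by (force simp: W_def orthogonal_def inner_commute intro: span_base)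
  have "(\<Sum>i\<in>- S. \<kappa> $ i) \<le> (\<Sum>i\<in>UNIV. \<kappa> $ i * \<tau> i)"
  proof (rule sum_complement_le_weighted_sum[OF \<open>0 \<le> c\<close> S])
    \<comment> \<open>\<open>\<tau> i\<close> is the squared norm of the projection of
      \<open>axis i 1\<close> onto \<open>W\<close>.\<close>
    show "\<tau> i \<le> 1" for i
      using Bessel_orthonormal_set[OF fin B(2,3), of "axis i 1"]
      by (simp add: \<tau>_def inner_axis)
    have "(\<Sum>i\<in>UNIV. \<tau> i) = (\<Sum>q\<in>B. q \<bullet> q)"
      unfolding \<tau>_def inner_vec_def by (subst sum.swap) (simp add: power2_eq_square)
    also have "\<dots> = card B"
      using B(3) by (simp add: norm_eq_1)
    finally show "real (card (- S)) \<le> (\<Sum>i\<in>UNIV. \<tau> i)"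
      using dimW ind(2) card by (simp add: Compl_eq_Diff_UNIV card_Diff_subset)
  qed (auto simp: \<tau>_def intro: sum_nonneg)
  also have "\<dots> \<le> (\<Sum>i\<in>UNIV. (norm (sqrt (\<kappa> $ i) *\<^sub>R axis i 1 - (\<Sum>j<s. a i j *\<^sub>R p j)))\<^sup>2)"
  proof (rule sum_mono)
    fix i
    let ?x = "sqrt (\<kappa> $ i) *\<^sub>R axis i 1 - (\<Sum>j<s. a i j *\<^sub>R p j)"
    have "q \<bullet> ?x = sqrt (\<kappa> $ i) * q $ i" if "q \<in> B" for q
      using orth[OF that] by (simp add: inner_diff_right inner_sum_right inner_axis)
    then have "\<kappa> $ i * \<tau> i = (\<Sum>q\<in>B. (q \<bullet> ?x)\<^sup>2)"
      using \<kappa> by (simp add: \<tau>_def sum_distrib_left power_mult_distrib)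
    also have "\<dots> \<le> (norm ?x)\<^sup>2" by (rule Bessel_orthonormal_set[OF fin B(2,3)])
    finally show "\<kappa> $ i * \<tau> i \<le> (norm ?x)\<^sup>2" .
  qed
  finally show ?thesis .
qed

section \<open>Reproducing kernel Hilbert spaces\<close>

context rkhs
begin

section \<open>Inner product calculus and Bessel's inequality in \<open>H\<close>\<close>

lemma sum_mem: "finite I \<Longrightarrow> (\<And>i. i \<in> I \<Longrightarrow> F i \<in> H) \<Longrightarrow> (\<lambda>x. \<Sum>i\<in>I. c i * F i x) \<in> H"
proof (induction I rule: finite_induct)
  case (insert j I)
  then show ?case using add_mem[OF scale_mem[of "F j" "c j"]] by simp
qed (simp add: zero_mem)

lemma ip_zero_left: "g \<in> H \<Longrightarrow> ip (\<lambda>x. 0) g = 0"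
  using ip_scale[OF zero_mem, of g 0] by simp

lemma ip_sum_left:
  assumes "finite I" "\<And>i. i \<in> I \<Longrightarrow> F i \<in> H" "g \<in> H"
  shows "ip (\<lambda>x. \<Sum>i\<in>I. c i * F i x) g = (\<Sum>i\<in>I. c i * ip (F i) g)"
  using assms(1,2)
proof (induction I rule: finite_induct)
  case empty
  then show ?case using assms(3) by (simp add: ip_zero_left)
next
  case (insert j I)
  have "ip (\<lambda>x. c j * F j x + (\<Sum>i\<in>I. c i * F i x)) g
      = ip (\<lambda>x. c j * F j x) g + ip (\<lambda>x. \<Sum>i\<in>I. c i * F i x) g"
    using insert assms(3) by (intro ip_add) (auto intro: scale_mem sum_mem)
  with insert assms(3) show ?case by (simp add: ip_scale)
qed

lemma ip_sum_right:
  assumes "finite I" "\<And>i. i \<in> I \<Longrightarrow> F i \<in> H" "g \<in> H"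
  shows "ip g (\<lambda>x. \<Sum>i\<in>I. c i * F i x) = (\<Sum>i\<in>I. c i * ip g (F i))"
proof -
  have "ip g (\<lambda>x. \<Sum>i\<in>I. c i * F i x) = ip (\<lambda>x. \<Sum>i\<in>I. c i * F i x) g"
    using assms by (intro ip_commute sum_mem)
  also have "\<dots> = (\<Sum>i\<in>I. c i * ip g (F i))"
    using assms by (auto simp: ip_sum_left intro!: sum.cong ip_commute)
  finally show ?thesis .
qed

lemma diff_mem: "f \<in> H \<Longrightarrow> g \<in> H \<Longrightarrow> (\<lambda>x. f x - g x) \<in> H"
  using add_mem[OF _ scale_mem[of g "-1"]] by simp

lemma ip_diff_left:
  "f \<in> H \<Longrightarrow> g \<in> H \<Longrightarrow> h \<in> H \<Longrightarrow> ip (\<lambda>x. f x - g x) h = ip f h - ip g h"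
  using ip_add[OF _ scale_mem[of g "-1"], of f h] ip_scale[of g h "-1"] by simp

lemma ip_diff_self:
  assumes "f \<in> H" "g \<in> H"
  shows "ip (\<lambda>x. f x - g x) (\<lambda>x. f x - g x) = ip f f - 2 * ip f g + ip g g"
proof -
  let ?d = "\<lambda>x. f x - g x"
  have d: "?d \<in> H" using assms by (rule diff_mem)
  have "ip ?d ?d = ip f ?d - ip g ?d" using assms d by (intro ip_diff_left)
  also have "ip f ?d = ip ?d f" using assms d by (intro ip_commute)
  also have "ip g ?d = ip ?d g" using assms d by (intro ip_commute)
  finally show ?thesis using assms by (simp add: ip_diff_left ip_commute[of g f])
qed

lemma ip_norm_nonneg: "f \<in> H \<Longrightarrow> 0 \<le> ip_norm ip f"
  by (simp add: ip_norm_def ip_nonneg)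

lemma ip_norm_sq: "f \<in> H \<Longrightarrow> (ip_norm ip f)\<^sup>2 = ip f f"
  by (simp add: ip_norm_def ip_nonneg)

lemma ip_Cauchy_Schwarz:
  assumes "f \<in> H" "g \<in> H"
  shows "\<bar>ip f g\<bar> \<le> ip_norm ip f * ip_norm ip g"
proof (cases "ip g g = 0")
  case True
  then have "g = (\<lambda>x. 0)" using assms ip_definite by blast
  then have "ip f g = 0" using assms ip_commute[of f g] by (simp add: ip_zero_left)
  then show ?thesis using assms by (simp add: ip_norm_nonneg)
next
  case False
  then have pos: "0 < ip g g" using ip_nonneg[OF assms(2)] by simp
  define c where "c = ip f g / ip g g"
  define h where "h = (\<lambda>x. c * g x)"
  have h: "h \<in> H" unfolding h_def using assms(2) by (rule scale_mem)
  have "ip h g = c * ip g g" "ip h f = c * ip g f" "ip h h = c * ip g h"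
    using ip_scale[OF assms(2) assms(2), of c] ip_scale[OF assms(2) assms(1), of c]
      ip_scale[OF assms(2) h, of c] by (simp_all only: h_def)
  then have hh: "ip f h = c * ip f g" "ip h h = c * (c * ip g g)"
    using ip_commute[OF assms(1) h] ip_commute[OF assms(2) h] ip_commute[OF assms] by auto
  have "0 \<le> ip (\<lambda>x. f x - h x) (\<lambda>x. f x - h x)"
    using assms h by (intro ip_nonneg diff_mem)
  also have "\<dots> = ip f f - 2 * (c * ip f g) + c * (c * ip g g)"
    unfolding ip_diff_self[OF assms(1) h] hh ..
  also have "\<dots> = ip f f - (ip f g)\<^sup>2 / ip g g"
    using pos by (simp add: c_def field_simps power2_eq_square)
  finally have "(ip f g)\<^sup>2 \<le> ip f f * ip g g" using pos by (simp add: field_simps)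
  also have "\<dots> = (ip_norm ip f * ip_norm ip g)\<^sup>2"
    using assms by (simp add: power_mult_distrib ip_norm_sq)
  finally show ?thesis
    using assms by (simp add: abs_le_square_iff[symmetric] ip_norm_nonneg)
qed

lemma section_ip: "ip (k x) (k y) = k x y"
  using section_mem reproducing by blast

lemma reproducing_left: "f \<in> H \<Longrightarrow> ip (k x) f = f x"
  by (metis ip_commute reproducing section_mem)

lemma k_sym: "k x y = k y x"
  using section_ip ip_commute section_mem by metis

lemma k_diag_nonneg: "0 \<le> k x x"
  using section_ip ip_nonneg section_mem by metis

lemma eval_bound: "f \<in> H \<Longrightarrow> \<bar>f x\<bar> \<le> ip_norm ip f * sqrt (k x x)"
  using ip_Cauchy_Schwarz[OF _ section_mem, of f x]
  by (simp add: reproducing section_ip ip_norm_def[of ip "k x"])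

text \<open>The norms are only bounded by one, because the systems used later contain zero
  functions: \<open>u m\<close> when \<open>\<kappa> $ m = 0\<close>, and Mercer functions with
  eigenvalue zero. The squared norm of the expansion is then at most its inner product with
  \<open>f\<close>, which is all that the estimate uses.\<close>

lemma Bessel_residual:
  assumes "finite I" "\<And>i. i \<in> I \<Longrightarrow> u i \<in> H" "f \<in> H"
    and orth: "\<And>i j. i \<in> I \<Longrightarrow> j \<in> I \<Longrightarrow> i \<noteq> j \<Longrightarrow> ip (u i) (u j) = 0"
    and le1: "\<And>i. i \<in> I \<Longrightarrow> ip (u i) (u i) \<le> 1"
  defines "r \<equiv> \<lambda>x. f x - (\<Sum>i\<in>I. ip f (u i) * u i x)"
  shows "r \<in> H" and "ip r r \<le> ip f f - (\<Sum>i\<in>I. (ip f (u i))\<^sup>2)"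
proof -
  let ?p = "\<lambda>x. \<Sum>i\<in>I. ip f (u i) * u i x"
  have p: "?p \<in> H" using assms by (intro sum_mem)
  then show "r \<in> H" unfolding r_def using assms by (intro diff_mem)
  have "ip f ?p = (\<Sum>i\<in>I. (ip f (u i))\<^sup>2)"
    using assms by (simp add: ip_sum_right power2_eq_square)
  moreover have "ip ?p ?p \<le> (\<Sum>i\<in>I. (ip f (u i))\<^sup>2)"
  proof -
    have "ip ?p ?p = (\<Sum>i\<in>I. ip f (u i) * (\<Sum>j\<in>I. ip f (u j) * ip (u i) (u j)))"
      using assms p by (simp add: ip_sum_left) (simp add: ip_sum_right)
    also have "\<dots> = (\<Sum>i\<in>I. ip f (u i) * (ip f (u i) * ip (u i) (u i)))"
    proof (intro sum.cong refl arg_cong2[where f = "(*)"])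
      fix i assume "i \<in> I"
      then have "(\<Sum>j\<in>I. ip f (u j) * ip (u i) (u j))
          = (\<Sum>j\<in>I. if j = i then ip f (u i) * ip (u i) (u i) else 0)"
        using orth by (intro sum.cong) auto
      with \<open>i \<in> I\<close> assms(1) show "(\<Sum>j\<in>I. ip f (u j) * ip (u i) (u j)) = ip f (u i) * ip (u i) (u i)"
        by simp
    qed
    also have "\<dots> \<le> (\<Sum>i\<in>I. (ip f (u i))\<^sup>2)"
    proof (rule sum_mono)
      fix i assume "i \<in> I"
      have "(ip f (u i))\<^sup>2 * ip (u i) (u i) \<le> (ip f (u i))\<^sup>2 * 1"
        using le1[OF \<open>i \<in> I\<close>] by (intro mult_left_mono) auto
      then show "ip f (u i) * (ip f (u i) * ip (u i) (u i)) \<le> (ip f (u i))\<^sup>2"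
        by (simp add: power2_eq_square mult.assoc)
    qed
    finally show ?thesis .
  qed
  ultimately show "ip r r \<le> ip f f - (\<Sum>i\<in>I. (ip f (u i))\<^sup>2)"
    unfolding r_def using ip_diff_self[OF \<open>f \<in> H\<close> p] by simp
qed

lemma Bessel_ip:
  assumes "finite I" "\<And>i. i \<in> I \<Longrightarrow> u i \<in> H" "f \<in> H"
    and "\<And>i j. i \<in> I \<Longrightarrow> j \<in> I \<Longrightarrow> i \<noteq> j \<Longrightarrow> ip (u i) (u j) = 0"
    and "\<And>i. i \<in> I \<Longrightarrow> ip (u i) (u i) \<le> 1"
  shows "(\<Sum>i\<in>I. (ip f (u i))\<^sup>2) \<le> ip f f"
  using Bessel_residual[of I u f, OF assms] ip_nonneg by fastforce

text \<open>Parametrises the span of the kernel sections at \<open>Z\<close> by coefficient vectors,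
  so that computations in \<open>H\<close> become matrix computations with \<open>gram k Z\<close>.
  Coefficients are not unique when that matrix is singular.\<close>

definition section_comb :: "('l::finite \<Rightarrow> 'a) \<Rightarrow> real^'l \<Rightarrow> 'a \<Rightarrow> real" where
  "section_comb Z c = (\<lambda>x. \<Sum>i\<in>UNIV. c $ i * k (Z i) x)"

lemma section_comb_mem: "section_comb Z c \<in> H"
  unfolding section_comb_def by (intro sum_mem) (auto intro: section_mem)

lemma section_comb_eq: "section_comb Z c x = c \<bullet> kvec k Z x"
  by (simp add: section_comb_def kvec_def inner_vec_def)

lemma ip_section_comb: "f \<in> H \<Longrightarrow> ip f (section_comb Z c) = c \<bullet> (\<chi> i. f (Z i))"
  unfolding section_comb_def
  by (subst ip_sum_right) (auto simp: section_mem reproducing inner_vec_def)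

lemma ip_section_combs: "ip (section_comb Z c) (section_comb Z d) = c \<bullet> (gram k Z *v d)"
proof -
  have "(\<chi> i. section_comb Z d (Z i)) = gram k Z *v d"
    by (auto simp: vec_eq_iff section_comb_def gram_def matrix_vector_mult_def
        intro!: sum.cong k_sym)
  moreover have "ip (section_comb Z d) (section_comb Z c) = c \<bullet> (\<chi> i. section_comb Z d (Z i))"
    by (simp add: ip_section_comb section_comb_mem)
  ultimately show ?thesis
    by (simp add: ip_commute[of "section_comb Z c" "section_comb Z d"] section_comb_mem)
qed

lemma gram_symmetric: "transpose (gram k Z) = gram k Z"
  unfolding gram_def transpose_def vec_eq_iff using k_sym by simp

end

section \<open>Truncated kernels\<close>

lemma integrable_mult_of_squares:
  fixes f g :: "'a \<Rightarrow> real"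
  assumes "f \<in> borel_measurable M" "g \<in> borel_measurable M"
    and "integrable M (\<lambda>x. (f x)\<^sup>2)" "integrable M (\<lambda>x. (g x)\<^sup>2)"
  shows "integrable M (\<lambda>x. f x * g x)"
proof (rule Bochner_Integration.integrable_bound)
  show "integrable M (\<lambda>x. (f x)\<^sup>2 + (g x)\<^sup>2)" using assms by simp
  have "\<bar>a * b\<bar> \<le> a\<^sup>2 + b\<^sup>2" for a b :: real
  proof -
    have "2 * (\<bar>a\<bar> * \<bar>b\<bar>) \<le> a\<^sup>2 + b\<^sup>2"
      using sum_squares_bound[of "\<bar>a\<bar>" "\<bar>b\<bar>"] by (simp add: mult.assoc)
    moreover have "0 \<le> \<bar>a\<bar> * \<bar>b\<bar>" by simp
    ultimately show ?thesis unfolding abs_mult by linarith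
  qed
  then show "AE x in M. norm (f x * g x) \<le> norm ((f x)\<^sup>2 + (g x)\<^sup>2)" by simp
qed (use assms in simp)

lemma ix_bij: "bij_betw (ix :: nat \<Rightarrow> 'l::{finite,linorder}) {..<CARD('l)} UNIV"
  unfolding ix_def using bij_betw_nth[of "sorted_list_of_set (UNIV :: 'l set)"] by simp

lemma ix_mono: "i \<le> j \<Longrightarrow> j < CARD('l) \<Longrightarrow> ix i \<le> (ix j :: 'l::{finite,linorder})"
  unfolding ix_def by (rule sorted_nth_mono) auto

text \<open>With \<open>c\<close> as coefficients, the section combination has squared norm
  k^Z(t,t), and the same inner product with \<open>k t\<close>. Its squared distance to
  \<open>k t\<close> is therefore k(t,t) - k^Z(t,t).\<close>

lemma (in rkhs) nystrom_nonneg: "0 \<le> nystrom k Z t t"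
  and nystrom_le: "nystrom k Z t t \<le> k t t"
proof -
  define c where "c = pinv (gram k Z) *v kvec k Z t"
  have "c \<bullet> (gram k Z *v c) = (kvec k Z t) \<bullet> ((pinv (gram k Z) ** gram k Z ** pinv (gram k Z)) *v kvec k Z t)"
    unfolding c_def matrix_vector_inner pinv_symmetric[OF gram_symmetric]
      matrix_vector_mul_assoc[symmetric] ..
  then have norm_sq: "ip (section_comb Z c) (section_comb Z c) = nystrom k Z t t"
    by (simp add: ip_section_combs pinv_2 nystrom_def c_def)
  then show "0 \<le> nystrom k Z t t"
    using ip_nonneg[OF section_comb_mem] by metis
  note norm_sq
  moreover have "ip (k t) (section_comb Z c) = nystrom k Z t t"
  proof -
    have "ip (k t) (section_comb Z c) = section_comb Z c t"
      by (rule reproducing_left[OF section_comb_mem])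
    then show ?thesis by (simp add: section_comb_eq nystrom_def c_def inner_commute)
  qed
  moreover have "0 \<le> ip (\<lambda>x. k t x - section_comb Z c x) (\<lambda>x. k t x - section_comb Z c x)"
    by (intro ip_nonneg diff_mem section_mem section_comb_mem)
  ultimately show "nystrom k Z t t \<le> k t t"
    using ip_diff_self[OF section_mem section_comb_mem, of t Z c] by (simp add: section_ip)
qed

text \<open>\<open>\<nu>\<close> stands for \<open>\<mu>\<close> or for the empirical measure of one
  fixed sample, so that both truncated kernels are treated at once.\<close>

locale trunc_system = rkhs k H ip
  for k :: "'a::t2_space \<Rightarrow> 'a \<Rightarrow> real" and H ip +
  fixes \<nu> :: "'a measure" and Z :: "'l::{finite,linorder} \<Rightarrow> 'a"
    and A V :: "real^'l::_^'l::_" and \<kappa> :: "real^'l::_"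
  assumes prob: "prob_space \<nu>" and sets_eq: "sets \<nu> = sets borel"
    and k_measurable: "\<And>x. k x \<in> borel_measurable borel"
    and diag_integrable: "integrable \<nu> (\<lambda>t. k t t)"
    and decomp: "trunc_decomp k \<nu> Z A V \<kappa>"
begin

text \<open>This rule rewrites \<open>transpose A *v x\<close> to \<open>x v* A\<close>; keeping the
  former shape lets the adjoint identity \<open>matrix_vector_inner\<close> match.\<close>

declare transpose_matrix_vector [simp del]

abbreviation "G \<equiv> gram k Z"
abbreviation "v m \<equiv> column m V"

text \<open>Indexed by the type \<open>'l\<close> instead of by position, so that sums over all of
  \<open>UNIV\<close> and over complements need no reindexing; \<open>trunc_fun_eq\<close>
  translates through \<open>ix\<close>.\<close>

definition F :: "'l \<Rightarrow> 'a \<Rightarrow> real" where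
  "F m = section_comb Z (pinv A *v v m)"

text \<open>Consider the map sending \<open>y\<close> to the section combination with coefficients
  G^+ A^T y. Its composition with its adjoint is A G^+ A^T, so the \<open>v m\<close> are right
  singular vectors with squared singular values \<open>\<kappa> $ m\<close>, and the
  \<open>u m\<close> are the normalised images. Since \<open>inverse 0 = 0\<close>,
  \<open>u m\<close> vanishes when \<open>\<kappa> $ m = 0\<close>.\<close>

definition u :: "'l \<Rightarrow> 'a \<Rightarrow> real" where
  "u m = section_comb Z (inverse (sqrt (\<kappa> $ m)) *\<^sub>R (pinv G *v (transpose A *v v m)))"

text \<open>Membership of k(Z,t) in the row space of \<open>A\<close>, expressed through the
  orthogonal projection \<open>pinv A ** A\<close>.\<close>

definition good :: "'a \<Rightarrow> bool" where
  "good t \<longleftrightarrow> pinv A *v (A *v kvec k Z t) = kvec k Z t"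

section \<open>The systems \<open>F\<close> and \<open>u\<close> and their values at good
  points\<close>

lemma F_mem: "F m \<in> H" and u_mem: "u m \<in> H"
  by (simp_all add: F_def u_def section_comb_mem)

lemma \<kappa>_nonneg: "0 \<le> \<kappa> $ i"
  using decomp by (simp add: trunc_decomp_def)

lemma \<kappa>_decreasing: "i \<le> j \<Longrightarrow> \<kappa> $ j \<le> \<kappa> $ i"
  using decomp by (simp add: trunc_decomp_def)

lemma v_inner: "v m \<bullet> v n = (if m = n then 1 else 0)"
proof -
  have "transpose V ** V = mat 1"
    using decomp by (simp add: trunc_decomp_def orthogonal_matrix_def)
  then have "(transpose V ** V) $ m $ n = mat 1 $ m $ n" by simp
  then show ?thesis by (simp add: matrix_mult_transpose_dot_column mat_def)
qed

lemma AGA_eq: "A *v (pinv G *v (transpose A *v y)) = V *v (diag_mat \<kappa> *v (transpose V *v y))"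
  using decomp by (simp add: trunc_decomp_def matrix_vector_mul_assoc matrix_mul_assoc)

lemma AGA_v: "A *v (pinv G *v (transpose A *v v m)) = \<kappa> $ m *\<^sub>R v m"
proof -
  have "transpose V *v v m = axis m 1"
    by (simp add: vec_eq_iff matrix_vector_mul_component transpose_def axis_def)
      (metis column_def v_inner)
  moreover have "diag_mat \<kappa> *v axis m 1 = \<kappa> $ m *\<^sub>R axis m 1"
    by (simp add: vec_eq_iff matrix_vector_mul_component diag_mat_def inner_axis) (simp add: axis_def)
  ultimately show ?thesis
    by (simp add: AGA_eq matrix_vector_mult_scaleR matrix_vector_mult_basis)
qed

lemma pinv_G_inner: "(pinv G *v x) \<bullet> y = x \<bullet> (pinv G *v y)"
  using matrix_vector_inner[of "pinv G" x y] by (simp add: pinv_symmetric gram_symmetric)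

lemma A_inner: "(A *v x) \<bullet> y = x \<bullet> (transpose A *v y)"
  by (rule matrix_vector_inner)

text \<open>The identity G^+ G G^+ = G^+ turns the inner product of the unnormalised functions into
  v_m . A G^+ A^T v_n, to which the eigenvector equation applies.\<close>

lemma u_ip: "ip (u m) (u n) = (if m = n \<and> 0 < \<kappa> $ m then 1 else 0)"
proof -
  let ?c = "\<lambda>m. pinv G *v (transpose A *v v m)"
  have "?c m \<bullet> (G *v ?c n) = (transpose A *v v m) \<bullet> ((pinv G ** G ** pinv G) *v (transpose A *v v n))"
    unfolding pinv_G_inner matrix_vector_mul_assoc[symmetric] ..
  also have "\<dots> = (transpose A *v v m) \<bullet> ?c n" by (simp add: pinv_2)
  also have "\<dots> = v m \<bullet> (A *v ?c n)"
    by (metis A_inner inner_commute)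
  also have "\<dots> = (if m = n then \<kappa> $ n else 0)" by (simp add: AGA_v v_inner)
  finally have "?c m \<bullet> (G *v ?c n) = (if m = n then \<kappa> $ n else 0)" .
  then show ?thesis
    using \<kappa>_nonneg[of m]
    by (auto simp: u_def ip_section_combs matrix_vector_mult_scaleR power2_eq_square[symmetric]
        field_simps real_sqrt_mult[symmetric] order_le_less)
qed

lemma good_kvec: "good t \<Longrightarrow> transpose A *v (transpose (pinv A) *v kvec k Z t) = kvec k Z t"
  unfolding good_def matrix_vector_mul_assoc matrix_transpose_mul[symmetric] pinv_4 .

lemma F_eq: "F m t = v m \<bullet> (transpose (pinv A) *v kvec k Z t)"
  by (simp add: F_def section_comb_eq matrix_vector_inner)

text \<open>At a good point k(Z,t) = A^T y with y = (A^+)^T k(Z,t). Moving A^T across the inner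
  product brings out A G^+ A^T v_m, which is \<open>\<kappa> $ m\<close> times
  \<open>v m\<close>.\<close>

lemma u_good:
  assumes "good t"
  shows "u m t = sqrt (\<kappa> $ m) * F m t"
proof -
  define y where "y = transpose (pinv A) *v kvec k Z t"
  have "(pinv G *v (transpose A *v v m)) \<bullet> (transpose A *v y)
      = (A *v (pinv G *v (transpose A *v v m))) \<bullet> y"
    by (simp add: A_inner)
  also have "\<dots> = \<kappa> $ m * F m t" by (simp add: AGA_v F_eq y_def)
  finally have "u m t = inverse (sqrt (\<kappa> $ m)) * (\<kappa> $ m * F m t)"
    using good_kvec[OF assms] by (simp add: u_def section_comb_eq y_def)
  \<comment> \<open>The cancellation also covers \<open>\<kappa> $ m = 0\<close>, where both sides
    vanish.\<close>
  also have "\<dots> = (inverse (sqrt (\<kappa> $ m)) * (sqrt (\<kappa> $ m) * sqrt (\<kappa> $ m))) * F m t"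
    using \<kappa>_nonneg[of m] by simp
  also have "inverse x * (x * x) = x" for x :: real by (cases "x = 0") auto
  finally show ?thesis .
qed

text \<open>The same substitution k(Z,t) = A^T y turns the quadratic form of G^+ into that of A G^+
  A^T, which \<open>V\<close> diagonalises. At good points k^Z is thus the untruncated sum.\<close>

lemma nystrom_good:
  assumes "good t"
  shows "nystrom k Z t t = (\<Sum>m\<in>UNIV. \<kappa> $ m * (F m t)\<^sup>2)"
proof -
  define y where "y = transpose (pinv A) *v kvec k Z t"
  have "nystrom k Z t t = (transpose A *v y) \<bullet> (pinv G *v (transpose A *v y))"
    using good_kvec[OF assms] by (simp add: nystrom_def y_def)
  also have "\<dots> = y \<bullet> (V *v (diag_mat \<kappa> *v (transpose V *v y)))"
    unfolding AGA_eq[symmetric] by (metis A_inner inner_commute)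
  also have "\<dots> = (transpose V *v y) \<bullet> (diag_mat \<kappa> *v (transpose V *v y))"
    by (metis matrix_vector_inner inner_commute)
  also have "\<dots> = (\<Sum>m\<in>UNIV. \<kappa> $ m * (F m t)\<^sup>2)"
  proof -
    have "(transpose V *v y) $ m = F m t" for m
      by (simp add: F_eq y_def matrix_vector_mul_component transpose_def column_def)
    moreover have "(diag_mat \<kappa> *v x) $ m = \<kappa> $ m * x $ m" for x m
      by (simp add: diag_mat_def matrix_vector_mult_def if_distrib[of "\<lambda>a. a * _"] cong: if_cong)
    ultimately show ?thesis
      by (simp add: inner_vec_def power2_eq_square mult_ac)
  qed
  finally show ?thesis .
qed

section \<open>Section combinations as elements of L^2(nu)\<close>

lemma measurable_cong_\<nu>: "f \<in> borel_measurable \<nu> \<longleftrightarrow> f \<in> borel_measurable borel"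
  using measurable_cong_sets[OF sets_eq refl] by blast

lemma section_comb_measurable: "section_comb Z c \<in> borel_measurable borel"
  unfolding section_comb_def using k_measurable by measurable

lemma F_measurable: "F m \<in> borel_measurable borel"
  and u_measurable: "u m \<in> borel_measurable borel"
  by (simp_all add: F_def u_def section_comb_measurable)

text \<open>The reproducing property bounds f(t)^2 by |f|^2 k(t,t), which is integrable.\<close>

lemma square_integrable:
  assumes "f \<in> H" "f \<in> borel_measurable borel"
  shows "integrable \<nu> (\<lambda>t. (f t)\<^sup>2)"
proof (rule Bochner_Integration.integrable_bound)
  show "integrable \<nu> (\<lambda>t. ip f f * k t t)" using diag_integrable by simp
  have "(f t)\<^sup>2 \<le> ip f f * k t t" for t
    using power_mono[OF eval_bound[OF assms(1), of t] abs_ge_zero, of 2] assms(1)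
    by (simp add: power_mult_distrib ip_norm_sq k_diag_nonneg)
  then show "AE t in \<nu>. norm ((f t)\<^sup>2) \<le> norm (ip f f * k t t)"
    by (simp add: order_trans[OF _ abs_ge_self])
  show "(\<lambda>t. (f t)\<^sup>2) \<in> borel_measurable \<nu>" using assms(2) by (simp add: measurable_cong_\<nu>)
qed

lemma product_integrable:
  assumes "f \<in> H" "f \<in> borel_measurable borel" "g \<in> H" "g \<in> borel_measurable borel"
  shows "integrable \<nu> (\<lambda>t. f t * g t)"
  using assms by (intro integrable_mult_of_squares square_integrable) (auto simp: measurable_cong_\<nu>)

text \<open>The L^2(nu) Gram matrix of the sections is h_nu(Z,Z) = A^T A. So \<open>A\<close>
  carries coefficients isometrically from L^2(nu) to Euclidean space, just as
  \<open>gram k Z\<close> encodes the geometry of \<open>H\<close>.\<close>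

lemma section_comb_integral:
  "(\<integral>t. section_comb Z c t * section_comb Z d t \<partial>\<nu>) = (A *v c) \<bullet> (A *v d)"
proof -
  have int: "integrable \<nu> (\<lambda>t. k x t * k y t)" for x y
    by (intro product_integrable section_mem k_measurable)
  have "(\<integral>t. section_comb Z c t * section_comb Z d t \<partial>\<nu>)
      = (\<integral>t. (\<Sum>i\<in>UNIV. \<Sum>j\<in>UNIV. c $ i * d $ j * (k (Z i) t * k (Z j) t)) \<partial>\<nu>)"
    by (simp add: section_comb_def sum_product mult_ac)
  also have "\<dots> = (\<Sum>i\<in>UNIV. \<Sum>j\<in>UNIV. c $ i * d $ j * (\<integral>t. k (Z i) t * k (Z j) t \<partial>\<nu>))"
    using int by (simp add: Bochner_Integration.integral_sum)
  also have "\<dots> = c \<bullet> (gram (h_kernel k \<nu>) Z *v d)"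
    using k_sym[of _ "Z _"]
    by (simp add: gram_def h_kernel_def inner_vec_def matrix_vector_mult_def sum_distrib_left mult_ac)
  also have "\<dots> = c \<bullet> (transpose A *v (A *v d))"
    using decomp by (simp add: trunc_decomp_def matrix_vector_mul_assoc)
  also have "\<dots> = (A *v c) \<bullet> (A *v d)" by (simp add: A_inner)
  finally show ?thesis .
qed

text \<open>Take a column of R = 1 - A^+ A as coefficients. Since A R = 0, the section combination
  has L^2(nu) norm zero and vanishes almost everywhere; as R is symmetric, its value at t is a
  component of R k(Z,t).\<close>

lemma AE_good: "AE t in \<nu>. good t"
proof -
  let ?R = "mat 1 - pinv A ** A"
  have "AE t in \<nu>. (?R *v kvec k Z t) $ i = 0" for i
  proof -
    define c where "c = ?R *v axis i 1"
    have "A *v c = 0"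
      by (simp add: c_def matrix_vector_mult_diff_rdistrib matrix_vector_mult_diff_distrib
          matrix_vector_mul_assoc matrix_mul_assoc pinv_1)
    then have "(\<integral>t. (section_comb Z c t)\<^sup>2 \<partial>\<nu>) = 0"
      using section_comb_integral[of c c] by (simp add: power2_eq_square)
    then have "AE t in \<nu>. (section_comb Z c t)\<^sup>2 = 0"
      by (subst (asm) integral_nonneg_eq_0_iff_AE)
        (auto intro: square_integrable section_comb_mem section_comb_measurable)
    moreover have "section_comb Z c t = (?R *v kvec k Z t) $ i" for t
    proof -
      have "transpose ?R = ?R"
        using pinv_4[of A] by (simp add: transpose_def vec_eq_iff mat_def)
      then have "c \<bullet> kvec k Z t = axis i 1 \<bullet> (?R *v kvec k Z t)"
        unfolding c_def by (simp add: matrix_vector_inner)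
      then show ?thesis by (simp add: section_comb_eq inner_axis')
    qed
    ultimately show ?thesis by simp
  qed
  then have "AE t in \<nu>. \<forall>i\<in>UNIV. (?R *v kvec k Z t) $ i = 0"
    by (subst AE_finite_all) auto
  then show ?thesis
    by (rule AE_mp) (auto simp: good_def vec_eq_iff matrix_vector_mult_diff_rdistrib
        matrix_vector_mul_assoc intro!: AE_I2)
qed

lemma F_integral: "(\<integral>t. F m t * F n t \<partial>\<nu>) = (A ** pinv A *v v m) \<bullet> (A ** pinv A *v v n)"
  unfolding F_def section_comb_integral by (simp add: matrix_vector_mul_assoc)

text \<open>For a positive eigenvalue the eigenvector equation places \<open>v m\<close> in the
  range of \<open>A\<close>, so the projection \<open>A ** pinv A\<close> fixes it.\<close>

lemma F_orthonormal:
  assumes "0 < \<kappa> $ m"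
  shows "(\<integral>t. F m t * F n t \<partial>\<nu>) = (if m = n then 1 else 0)"
proof -
  have "v m = A *v (inverse (\<kappa> $ m) *\<^sub>R (pinv G *v (transpose A *v v m)))"
    using assms by (simp add: matrix_vector_mult_scaleR AGA_v)
  then have "A ** pinv A *v v m = v m"
    by (metis matrix_vector_mul_assoc pinv_1)
  moreover have "v m \<bullet> (A ** pinv A *v v n) = (A ** pinv A *v v m) \<bullet> v n"
    by (simp add: matrix_vector_inner pinv_3)
  ultimately show ?thesis by (simp add: F_integral v_inner)
qed

text \<open>The \<open>F m\<close> with \<open>\<kappa> $ m = 0\<close> need not be normalised, but the Gram matrix of the
  whole family is at most the identity, which is enough for Bessel's inequality.\<close>

lemma F_Bessel:
  assumes w: "w \<in> H" "w \<in> borel_measurable borel"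
  shows "(\<Sum>m\<in>UNIV. (\<integral>t. w t * F m t \<partial>\<nu>)\<^sup>2) \<le> (\<integral>t. (w t)\<^sup>2 \<partial>\<nu>)"
proof -
  define c :: "real^'l::_" where "c = (\<chi> m. \<integral>t. w t * F m t \<partial>\<nu>)"
  define \<psi> where "\<psi> = section_comb Z (pinv A *v (V *v c))"
  have \<psi>: "\<psi> \<in> H" "\<psi> \<in> borel_measurable borel"
    by (simp_all add: \<psi>_def section_comb_mem section_comb_measurable)
  have "V *v c = (\<Sum>m\<in>UNIV. c $ m *\<^sub>R v m)"
    by (simp add: matrix_mult_sum scalar_mult_eq_scaleR)
  then have \<psi>_eq: "\<psi> t = (\<Sum>m\<in>UNIV. c $ m * F m t)" for t
    by (simp add: \<psi>_def F_def section_comb_eq linear_sum[OF matrix_vector_mul_linear]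
        matrix_vector_mult_scaleR inner_sum_left)
  have "(\<integral>t. w t * \<psi> t \<partial>\<nu>) = (\<integral>t. (\<Sum>m\<in>UNIV. c $ m * (w t * F m t)) \<partial>\<nu>)"
    by (simp add: \<psi>_eq sum_distrib_left mult_ac)
  also have "\<dots> = (\<Sum>m\<in>UNIV. (c $ m)\<^sup>2)"
    using w F_mem F_measurable
    by (simp add: Bochner_Integration.integral_sum product_integrable c_def power2_eq_square)
  finally have w\<psi>: "(\<integral>t. w t * \<psi> t \<partial>\<nu>) = (\<Sum>m\<in>UNIV. (c $ m)\<^sup>2)" .
  have "(\<integral>t. \<psi> t * \<psi> t \<partial>\<nu>) = (norm (A ** pinv A *v (V *v c)))\<^sup>2"
    unfolding \<psi>_def section_comb_integral power2_norm_eq_inner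
    by (simp add: matrix_vector_mul_assoc matrix_mul_assoc)
  also have "\<dots> \<le> (norm (V *v c))\<^sup>2"
    by (intro power_mono range_projection_contraction) simp
  also have "\<dots> = c \<bullet> ((transpose V ** V) *v c)"
    unfolding power2_norm_eq_inner by (simp add: matrix_vector_inner matrix_vector_mul_assoc)
  also have "\<dots> = (\<Sum>m\<in>UNIV. (c $ m)\<^sup>2)"
    using decomp by (simp add: trunc_decomp_def orthogonal_matrix_def inner_vec_def power2_eq_square)
  finally have \<psi>\<psi>: "(\<integral>t. \<psi> t * \<psi> t \<partial>\<nu>) \<le> (\<Sum>m\<in>UNIV. (c $ m)\<^sup>2)" .
  \<comment> \<open>With <w, psi> = |c|^2 and |psi|^2 at most |c|^2, expanding this square leaves
    |w|^2 - |c|^2 as an upper bound of a nonnegative number.\<close>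
  have "0 \<le> (\<integral>t. (w t - \<psi> t)\<^sup>2 \<partial>\<nu>)" by simp
  also have "\<dots> = (\<integral>t. (w t * w t - 2 * (w t * \<psi> t)) + \<psi> t * \<psi> t \<partial>\<nu>)"
    by (simp add: power2_eq_square algebra_simps)
  also have "\<dots> = (\<integral>t. w t * w t \<partial>\<nu>) - 2 * (\<integral>t. w t * \<psi> t \<partial>\<nu>) + (\<integral>t. \<psi> t * \<psi> t \<partial>\<nu>)"
    using w \<psi> by (simp add: product_integrable)
  finally show ?thesis using w\<psi> \<psi>\<psi> by (simp add: c_def power2_eq_square)
qed

text \<open>The left side is the sum of the discarded eigenvalues. Eckart-Young bounds it by the
  squared coefficients of the functions \<open>w m\<close> against the \<open>F n\<close>, where
  \<open>w m\<close> is \<open>u m\<close> minus its Bessel expansion in the \<open>b j\<close>.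
  Bessel in L^2(nu) passes from these coefficients to the norms of the \<open>w m\<close>, and
  Bessel in \<open>H\<close> bounds the sum of the squares of the \<open>w m\<close> at each
  point.\<close>

lemma tail_bound:
  fixes b :: "nat \<Rightarrow> 'a \<Rightarrow> real"
  assumes b: "\<And>j. j < s \<Longrightarrow> b j \<in> H" "\<And>j. j < s \<Longrightarrow> b j \<in> borel_measurable borel"
    and orth: "\<And>i j. i < s \<Longrightarrow> j < s \<Longrightarrow> i \<noteq> j \<Longrightarrow> ip (b i) (b j) = 0"
    and le1: "\<And>j. j < s \<Longrightarrow> ip (b j) (b j) \<le> 1"
    and S: "S = ix ` {..<s}" "s \<le> CARD('l)"
  shows "(\<integral>t. (\<Sum>m\<in>- S. \<kappa> $ m * (F m t)\<^sup>2) \<partial>\<nu>) \<le> (\<integral>t. k t t - (\<Sum>j<s. (b j t)\<^sup>2) \<partial>\<nu>)"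
proof -
  define a where "a m j = ip (b j) (u m)" for m j
  define w where "w m = (\<lambda>t. u m t - (\<Sum>j<s. a m j * b j t))" for m
  define p :: "nat \<Rightarrow> real^'l::_" where "p j = (\<chi> m. \<integral>t. b j t * F m t \<partial>\<nu>)" for j
  have w: "w m \<in> H" "w m \<in> borel_measurable borel" for m
  proof -
    show "w m \<in> H" unfolding w_def using b by (intro diff_mem u_mem sum_mem) auto
    show "w m \<in> borel_measurable borel"
      unfolding w_def using b(2) u_measurable
      by (intro borel_measurable_diff borel_measurable_sum borel_measurable_times) auto
  qed
  \<comment> \<open>The value \<open>w m t\<close> equals <r, u_m>, where \<open>r\<close> is the
    residual of \<open>k t\<close> after its expansion in the \<open>b j\<close>; so Bessel for the
    \<open>u m\<close> bounds the sum by |r|^2.\<close>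
  have pointwise: "(\<Sum>m\<in>UNIV. (w m t)\<^sup>2) \<le> k t t - (\<Sum>j<s. (b j t)\<^sup>2)" for t
  proof -
    define r where "r = (\<lambda>x. k t x - (\<Sum>j<s. ip (k t) (b j) * b j x))"
    have r: "r \<in> H" "ip r r \<le> ip (k t) (k t) - (\<Sum>j<s. (ip (k t) (b j))\<^sup>2)"
      unfolding r_def using b orth le1 section_mem by (auto intro!: Bessel_residual)
    have "ip r (u m) = w m t" for m
    proof -
      have "ip r (u m) = ip (k t) (u m) - ip (\<lambda>x. \<Sum>j<s. ip (k t) (b j) * b j x) (u m)"
        unfolding r_def using b by (intro ip_diff_left section_mem u_mem sum_mem) auto
      also have "\<dots> = ip (k t) (u m) - (\<Sum>j<s. ip (k t) (b j) * ip (b j) (u m))"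
        using b by (subst ip_sum_left) (auto simp: u_mem)
      also have "\<dots> = w m t"
        using b by (simp add: w_def a_def reproducing_left u_mem mult.commute)
      finally show ?thesis .
    qed
    then have "(\<Sum>m\<in>UNIV. (w m t)\<^sup>2) \<le> ip r r"
      using Bessel_ip[of UNIV u r] r(1) by (simp add: u_mem u_ip)
    also have "\<dots> \<le> k t t - (\<Sum>j<s. (b j t)\<^sup>2)"
      using r(2) b by (simp add: section_ip reproducing_left)
    finally show ?thesis .
  qed
  have w_coeff: "(\<integral>t. w m t * F n t \<partial>\<nu>) = (sqrt (\<kappa> $ m) *\<^sub>R axis m 1 - (\<Sum>j<s. a m j *\<^sub>R p j)) $ n"
    for m n
  proof -
    have "(\<integral>t. w m t * F n t \<partial>\<nu>)
        = (\<integral>t. u m t * F n t - (\<Sum>j<s. a m j * (b j t * F n t)) \<partial>\<nu>)"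
      unfolding w_def left_diff_distrib sum_distrib_right mult.assoc ..
    also have "\<dots> = (\<integral>t. u m t * F n t \<partial>\<nu>) - (\<Sum>j<s. a m j * (\<integral>t. b j t * F n t \<partial>\<nu>))"
    proof -
      have int: "integrable \<nu> (\<lambda>t. a m j * (b j t * F n t))" if "j < s" for j
        using b that F_mem F_measurable by (simp add: product_integrable)
      then have "integrable \<nu> (\<lambda>t. \<Sum>j<s. a m j * (b j t * F n t))"
        by (intro Bochner_Integration.integrable_sum) simp
      moreover have "integrable \<nu> (\<lambda>t. u m t * F n t)"
        by (intro product_integrable u_mem u_measurable F_mem F_measurable)
      moreover have "(\<integral>t. (\<Sum>j<s. a m j * (b j t * F n t)) \<partial>\<nu>)
          = (\<Sum>j<s. a m j * (\<integral>t. b j t * F n t \<partial>\<nu>))"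
        using int by (subst Bochner_Integration.integral_sum) auto
      ultimately show ?thesis by simp
    qed
    \<comment> \<open>\<open>u m\<close> agrees with its multiple of \<open>F m\<close> only at good
      points, which suffices under the integral.\<close>
    also have "(\<integral>t. u m t * F n t \<partial>\<nu>) = (\<integral>t. sqrt (\<kappa> $ m) * (F m t * F n t) \<partial>\<nu>)"
      using u_measurable F_measurable AE_good
      by (intro integral_cong_AE) (auto simp: measurable_cong_\<nu> u_good)
    also have "\<dots> = (sqrt (\<kappa> $ m) *\<^sub>R axis m 1) $ n"
      using F_orthonormal[of m n] \<kappa>_nonneg[of m]
      by (cases "\<kappa> $ m = 0") (auto simp: axis_def)
    finally show ?thesis by (simp add: p_def)
  qed
  have "(\<integral>t. (\<Sum>m\<in>- S. \<kappa> $ m * (F m t)\<^sup>2) \<partial>\<nu>) = (\<Sum>m\<in>- S. \<kappa> $ m * (\<integral>t. (F m t)\<^sup>2 \<partial>\<nu>))"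
    using F_mem F_measurable by (simp add: Bochner_Integration.integral_sum square_integrable)
  also have "\<dots> = (\<Sum>m\<in>- S. \<kappa> $ m)"
  proof (rule sum.cong)
    show "\<kappa> $ m * (\<integral>t. (F m t)\<^sup>2 \<partial>\<nu>) = \<kappa> $ m" for m
      using F_orthonormal[of m m] \<kappa>_nonneg[of m]
      by (cases "\<kappa> $ m = 0") (auto simp: power2_eq_square)
  qed simp
  also have "\<dots> \<le> (\<Sum>m\<in>UNIV. (norm (sqrt (\<kappa> $ m) *\<^sub>R axis m 1 - (\<Sum>j<s. a m j *\<^sub>R p j)))\<^sup>2)"
  \<comment> \<open>The threshold is the largest discarded eigenvalue, at position \<open>s\<close>
    counted from 0. If \<open>s\<close> equals CARD('l), nothing is discarded and 0 serves.\<close>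
  proof (rule Eckart_Young_diagonal[where c = "if s < CARD('l) then \<kappa> $ ix s else 0"])
    show "card S = s"
      using S ix_bij by (metis bij_betw_def card_image card_lessThan inj_on_subset lessThan_subset_iff)
    show "(if s < CARD('l) then \<kappa> $ ix s else 0) \<le> \<kappa> $ i" if "i \<in> S" for i
      using that S by (auto intro!: \<kappa>_decreasing ix_mono \<kappa>_nonneg)
    show "\<kappa> $ i \<le> (if s < CARD('l) then \<kappa> $ ix s else 0)" if "i \<notin> S" for i
    proof -
      obtain n where n: "n < CARD('l)" "i = ix n"
        using ix_bij by (metis bij_betw_def imageE lessThan_iff UNIV_I)
      with that S have "s \<le> n" by auto
      then show ?thesis using n by (auto intro!: \<kappa>_decreasing ix_mono)
    qed
  qed (auto simp: \<kappa>_nonneg)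
  also have "\<dots> = (\<Sum>m\<in>UNIV. \<Sum>n\<in>UNIV. (\<integral>t. w m t * F n t \<partial>\<nu>)\<^sup>2)"
    unfolding power2_norm_eq_inner w_coeff by (simp add: inner_vec_def power2_eq_square)
  also have "\<dots> \<le> (\<Sum>m\<in>UNIV. \<integral>t. (w m t)\<^sup>2 \<partial>\<nu>)"
    by (intro sum_mono F_Bessel w)
  also have "\<dots> = (\<integral>t. (\<Sum>m\<in>UNIV. (w m t)\<^sup>2) \<partial>\<nu>)"
    using w by (simp add: Bochner_Integration.integral_sum square_integrable)
  also have "\<dots> \<le> (\<integral>t. k t t - (\<Sum>j<s. (b j t)\<^sup>2) \<partial>\<nu>)"
    using w b pointwise diag_integrable
    by (intro integral_mono) (auto intro!: Bochner_Integration.integrable_sum square_integrable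
        Bochner_Integration.integrable_diff)
  finally show ?thesis .
qed

section \<open>Quadrature error for samples of good points\<close>

lemma trunc_fun_eq: "trunc_fun k Z A V i = F (ix i)"
  by (simp add: trunc_fun_def F_def section_comb_eq fun_eq_iff)

lemma finite_rank_eq:
  assumes "s \<le> CARD('l)"
  shows "finite_rank_kernel s (\<lambda>i. \<kappa> $ ix i) (trunc_fun k Z A V) t t
    = (\<Sum>m\<in>ix ` {..<s}. \<kappa> $ m * (F m t)\<^sup>2)"
proof -
  have "inj_on (ix :: nat \<Rightarrow> 'l) {..<s}"
    using ix_bij assms by (metis bij_betw_def inj_on_subset lessThan_subset_iff)
  then show ?thesis
    by (simp add: finite_rank_kernel_def trunc_fun_eq sum.reindex power2_eq_square mult.assoc)
qed

text \<open>By duality the remainder of \<open>f\<close> at \<open>t\<close> is the inner product of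
  \<open>f\<close> with the remainder \<open>r\<close> of \<open>k t\<close>. Bessel gives |r|^2 at
  most k(t,t) minus the sum of u_m(t)^2, and at a good point u_m(t)^2 is
  \<open>\<kappa> $ m * (F m t)\<^sup>2\<close>.\<close>

lemma residual_bound:
  assumes "f \<in> H" "ip_norm ip f \<le> 1" "good t"
  shows "\<bar>f t - (\<Sum>m\<in>S. ip f (u m) * u m t)\<bar> \<le> sqrt (k t t - (\<Sum>m\<in>S. \<kappa> $ m * (F m t)\<^sup>2))"
proof -
  define r where "r = (\<lambda>x. k t x - (\<Sum>m\<in>S. ip (k t) (u m) * u m x))"
  have r: "r \<in> H" "ip r r \<le> ip (k t) (k t) - (\<Sum>m\<in>S. (ip (k t) (u m))\<^sup>2)"
    unfolding r_def using Bessel_residual[of S u "k t"] by (auto simp: section_mem u_mem u_ip)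
  have "f t - (\<Sum>m\<in>S. ip f (u m) * u m t) = ip r f"
  proof -
    have "ip r f = ip (k t) f - ip (\<lambda>x. \<Sum>m\<in>S. ip (k t) (u m) * u m x) f"
      unfolding r_def using assms by (intro ip_diff_left section_mem u_mem sum_mem) auto
    also have "\<dots> = f t - (\<Sum>m\<in>S. ip (k t) (u m) * ip (u m) f)"
      using assms by (subst ip_sum_left) (auto simp: u_mem reproducing_left)
    finally show ?thesis
      using assms by (simp add: reproducing_left u_mem ip_commute[OF \<open>f \<in> H\<close> u_mem] mult.commute)
  qed
  also have "\<bar>\<dots>\<bar> \<le> ip_norm ip r * ip_norm ip f"
    using r(1) assms(1) by (rule ip_Cauchy_Schwarz)
  also have "\<dots> \<le> ip_norm ip r"
    using assms r(1) by (intro mult_left_le ip_norm_nonneg)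
  also have "\<dots> \<le> sqrt (k t t - (\<Sum>m\<in>S. \<kappa> $ m * (F m t)\<^sup>2))"
    using r(2) assms(3)
    by (simp add: ip_norm_def section_ip reproducing_left u_mem u_good power_mult_distrib \<kappa>_nonneg)
  finally show ?thesis .
qed

lemma quad_error:
  assumes KQ: "KQuad k s (\<lambda>i. \<kappa> $ ix i) (trunc_fun k Z A V) N y w x"
    and good: "\<And>j. j < N \<Longrightarrow> good (y j)" and s: "s \<le> CARD('l)"
    and f: "f \<in> H" "ip_norm ip f \<le> 1"
  shows "\<bar>quad (s + 1) w x f - emp_mean N y f\<bar>
    \<le> 2 * emp_mean N y (\<lambda>t. sqrt (k t t - (\<Sum>m\<in>ix ` {..<s}. \<kappa> $ m * (F m t)\<^sup>2)))"
proof -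
  define S :: "'l set" where "S = ix ` {..<s}"
  define g where "g = (\<lambda>t. sqrt (k t t - (\<Sum>m\<in>S. \<kappa> $ m * (F m t)\<^sup>2)))"
  define p where "p = (\<lambda>t. \<Sum>m\<in>S. ip f (u m) * u m t)"
  have w: "\<And>i. i < s + 1 \<Longrightarrow> 0 \<le> w i" and x: "\<And>i. i < s + 1 \<Longrightarrow> x i \<in> y ` {..<N}"
    and moments: "\<And>i. i < s \<Longrightarrow> quad (s + 1) w x (F (ix i)) = emp_mean N y (F (ix i))"
    and Q_g: "quad (s + 1) w x g \<le> emp_mean N y g"
    using KQ finite_rank_eq[OF s]
    by (auto simp: KQuad_def convex_weights_def trunc_fun_eq Let_def g_def S_def)
  have good_x: "good (x i)" if "i < s + 1" for i
    using x[OF that] good by auto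
  \<comment> \<open>The moment conditions concern \<open>F\<close>. Nodes and sample points are
    good, so multiplying by sqrt(kappa_m) carries the conditions over to \<open>u m\<close>.\<close>
  have "quad (s + 1) w x (u m) = emp_mean N y (u m)" if "m \<in> S" for m
  proof -
    have "quad (s + 1) w x (u m) = sqrt (\<kappa> $ m) * quad (s + 1) w x (F m)"
      unfolding quad_def sum_distrib_left using good_x by (intro sum.cong) (auto simp: u_good)
    also have "quad (s + 1) w x (F m) = emp_mean N y (F m)"
      using that moments by (auto simp: S_def)
    also have "sqrt (\<kappa> $ m) * emp_mean N y (F m) = emp_mean N y (u m)"
      unfolding emp_mean_def times_divide_eq_right sum_distrib_left
      using good by (intro arg_cong2[where f = "(/)"] sum.cong) (auto simp: u_good)
    finally show ?thesis .
  qed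
  moreover have "quad (s + 1) w x p = (\<Sum>m\<in>S. ip f (u m) * quad (s + 1) w x (u m))"
    unfolding p_def quad_def sum_distrib_left by (subst sum.swap) (simp add: mult_ac)
  moreover have "emp_mean N y p = (\<Sum>m\<in>S. ip f (u m) * emp_mean N y (u m))"
    unfolding p_def emp_mean_def sum_divide_distrib sum_distrib_left times_divide_eq_right
    by (subst sum.swap) simp
  ultimately have eq: "quad (s + 1) w x p = emp_mean N y p" by simp
  have bound: "\<bar>f t - p t\<bar> \<le> g t" if "good t" for t
    unfolding p_def g_def using residual_bound[OF f that] .
  have "quad (s + 1) w x f - emp_mean N y f
      = quad (s + 1) w x (\<lambda>t. f t - p t) - emp_mean N y (\<lambda>t. f t - p t)"
    using eq by (simp add: quad_def emp_mean_def right_diff_distrib sum_subtractf diff_divide_distrib)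
  moreover have "\<bar>quad (s + 1) w x (\<lambda>t. f t - p t)\<bar> \<le> quad (s + 1) w x g"
    unfolding quad_def
  proof (rule order_trans[OF sum_abs], rule sum_mono)
    fix i assume "i \<in> {..<s + 1}"
    then show "\<bar>w i * (f (x i) - p (x i))\<bar> \<le> w i * g (x i)"
      using w[of i] bound[OF good_x[of i]] by (simp add: abs_mult mult_left_mono)
  qed
  moreover have "\<bar>emp_mean N y (\<lambda>t. f t - p t)\<bar> \<le> emp_mean N y g"
    unfolding emp_mean_def abs_divide
    by (simp, intro divide_right_mono order_trans[OF sum_abs] sum_mono bound good) auto
  ultimately show ?thesis using Q_g unfolding g_def S_def by linarith
qed

text \<open>Splits k - k_s into the Nystrom gap k - k^Z and the discarded terms k^Z - k_s; both are
  nonnegative, so the square root is subadditive on them.\<close>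

lemma residual_split:
  assumes "good t"
  shows "sqrt (k t t - (\<Sum>m\<in>S. \<kappa> $ m * (F m t)\<^sup>2))
    \<le> sqrt (k t t - nystrom k Z t t) + sqrt (\<Sum>m\<in>- S. \<kappa> $ m * (F m t)\<^sup>2)"
proof -
  have "nystrom k Z t t = (\<Sum>m\<in>S. \<kappa> $ m * (F m t)\<^sup>2) + (\<Sum>m\<in>- S. \<kappa> $ m * (F m t)\<^sup>2)"
    unfolding nystrom_good[OF assms]
    by (subst sum.union_disjoint[symmetric]) (auto simp: Compl_partition)
  then have "k t t - (\<Sum>m\<in>S. \<kappa> $ m * (F m t)\<^sup>2)
      = (k t t - nystrom k Z t t) + (\<Sum>m\<in>- S. \<kappa> $ m * (F m t)\<^sup>2)" by simp
  also have "sqrt \<dots> \<le> sqrt (k t t - nystrom k Z t t) + sqrt (\<Sum>m\<in>- S. \<kappa> $ m * (F m t)\<^sup>2)"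
    using nystrom_le[of Z t] \<kappa>_nonneg by (intro sqrt_add_le_add_sqrt sum_nonneg) auto
  finally show ?thesis .
qed

end

section \<open>Sample means and the Mercer expansion\<close>

text \<open>Jensen's inequality for the square root, obtained from the nonnegative variance of
  sqrt(X).\<close>

lemma (in prob_space) expectation_sqrt_le:
  assumes "integrable M X" "\<And>x. 0 \<le> X x"
  shows "integrable M (\<lambda>x. sqrt (X x))" "expectation (\<lambda>x. sqrt (X x)) \<le> sqrt (expectation X)"
proof -
  show int: "integrable M (\<lambda>x. sqrt (X x))"
  proof (rule Bochner_Integration.integrable_bound)
    show "integrable M (\<lambda>x. 1 + X x)" using assms(1) by simp
    have "sqrt a \<le> 1 + a" if "0 \<le> a" for a :: real
      using that by (intro real_le_lsqrt) (auto simp: power2_eq_square algebra_simps)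
    then show "AE x in M. norm (sqrt (X x)) \<le> norm (1 + X x)" using assms(2) by simp
  qed (use assms(1) in simp)
  have "(expectation (\<lambda>x. sqrt (X x)))\<^sup>2 \<le> expectation X"
    using variance_eq[OF int] variance_positive[of "\<lambda>x. sqrt (X x)"] assms by simp
  then show "expectation (\<lambda>x. sqrt (X x)) \<le> sqrt (expectation X)"
    by (rule real_le_rsqrt)
qed

text \<open>Independence and zero means remove the off-diagonal products, leaving N terms
  \<open>v\<close> over N^2.\<close>

lemma (in prob_space) sample_mean_second_moment:
  fixes X :: "nat \<Rightarrow> 'a \<Rightarrow> real"
  assumes ind: "indep_vars (\<lambda>_. borel) X {..<N}" and "0 < N"
    and sq: "\<And>j. j < N \<Longrightarrow> integrable M (\<lambda>\<omega>. (X j \<omega>)\<^sup>2)"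
    and mean: "\<And>j. j < N \<Longrightarrow> expectation (X j) = 0"
    and second: "\<And>j. j < N \<Longrightarrow> expectation (\<lambda>\<omega>. (X j \<omega>)\<^sup>2) = v"
  shows "integrable M (\<lambda>\<omega>. ((\<Sum>j<N. X j \<omega>) / real N)\<^sup>2)"
    and "expectation (\<lambda>\<omega>. ((\<Sum>j<N. X j \<omega>) / real N)\<^sup>2) = v / real N"
proof -
  have meas: "X j \<in> borel_measurable M" if "j < N" for j
    using ind that unfolding indep_vars_def by auto
  have int: "integrable M (X j)" if "j < N" for j
    using square_integrable_imp_integrable[OF meas[OF that] sq[OF that]] .
  have pair: "integrable M (\<lambda>\<omega>. X i \<omega> * X j \<omega>) \<and>
      expectation (\<lambda>\<omega>. X i \<omega> * X j \<omega>) = (if i = j then v else 0)" if "i < N" "j < N" for i j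
  proof (cases "i = j")
    case True
    then show ?thesis using sq second that by (simp add: power2_eq_square)
  next
    case False
    have "indep_vars (\<lambda>_. borel) X {i, j}"
      using that by (intro indep_vars_subset[OF ind]) auto
    from indep_vars_lebesgue_integral[OF _ this] indep_vars_integrable[OF _ this]
    show ?thesis using False that int mean by auto
  qed
  have eq: "((\<Sum>j<N. X j \<omega>) / real N)\<^sup>2 = (\<Sum>i<N. \<Sum>j<N. X i \<omega> * X j \<omega>) / (real N)\<^sup>2" for \<omega>
    by (simp add: power_divide power2_eq_square sum_product)
  show "integrable M (\<lambda>\<omega>. ((\<Sum>j<N. X j \<omega>) / real N)\<^sup>2)"
    unfolding eq using pair by (intro Bochner_Integration.integrable_divide
        Bochner_Integration.integrable_sum) auto
  have "expectation (\<lambda>\<omega>. \<Sum>i<N. \<Sum>j<N. X i \<omega> * X j \<omega>)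
      = (\<Sum>i<N. \<Sum>j<N. expectation (\<lambda>\<omega>. X i \<omega> * X j \<omega>))"
    using pair by (subst Bochner_Integration.integral_sum; (intro Bochner_Integration.integrable_sum)?)
      (auto intro!: sum.cong Bochner_Integration.integral_sum)
  also have "\<dots> = (\<Sum>i<N. \<Sum>j<N. if i = j then v else 0)"
    by (intro sum.cong refl) (use pair in auto)
  also have "\<dots> = real N * v" by simp
  finally have "expectation (\<lambda>\<omega>. ((\<Sum>j<N. X j \<omega>) / real N)\<^sup>2) = real N * v / (real N)\<^sup>2"
    unfolding eq by simp
  then show "expectation (\<lambda>\<omega>. ((\<Sum>j<N. X j \<omega>) / real N)\<^sup>2) = v / real N"
    using \<open>0 < N\<close> by (simp add: power2_eq_square)
qed

section \<open>Integration against the empirical measure\<close>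

lemma prob_space_empirical:
  assumes "0 < N"
  shows "prob_space (empirical_measure N y)"
proof -
  interpret prob_space "uniform_count_measure {..<N}"
    using assms by (intro prob_space_uniform_count_measure) auto
  show ?thesis unfolding empirical_measure_def
    by (intro prob_space_distr) (simp add: measurable_def sets_uniform_count_measure
        space_uniform_count_measure)
qed

lemma empirical_measurable: "y \<in> measurable (uniform_count_measure {..<N}) borel"
  by (auto simp: measurable_def sets_uniform_count_measure space_uniform_count_measure)

lemma integral_empirical:
  assumes "f \<in> borel_measurable borel"
  shows "(\<integral>t. f t \<partial>empirical_measure N y) = emp_mean N y f"
  unfolding empirical_measure_def emp_mean_def
  using assms by (simp add: integral_distr[OF empirical_measurable] integral_uniform_count_measure)

lemma integrable_empirical:
  fixes f :: "'a::topological_space \<Rightarrow> real"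
  assumes "f \<in> borel_measurable borel"
  shows "integrable (empirical_measure N y) f"
  unfolding empirical_measure_def
  by (subst integrable_distr_eq[OF empirical_measurable assms])
    (simp add: uniform_count_measure_def integrable_point_measure_finite)

text \<open>Every sample point carries positive mass, so nothing can fail there. For the empirical
  measure this makes all sample points good.\<close>

lemma AE_empirical:
  assumes "AE t in empirical_measure N y. P t" "j < N"
  shows "P (y j)"
proof -
  have "AE j in uniform_count_measure {..<N}. P (y j)"
    using AE_distrD[OF empirical_measurable] assms(1) unfolding empirical_measure_def by blast
  then show ?thesis
    using assms(2) unfolding uniform_count_measure_def AE_point_measure
    by (auto simp: ennreal_zero_less_divide)
qed

lemma emp_mean_mono: "(\<And>j. j < N \<Longrightarrow> f (y j) \<le> g (y j)) \<Longrightarrow> emp_mean N y f \<le> emp_mean N y g"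
  unfolding emp_mean_def by (intro divide_right_mono sum_mono) auto

lemma emp_mean_add: "emp_mean N y (\<lambda>t. f t + g t) = emp_mean N y f + emp_mean N y g"
  by (simp add: emp_mean_def sum.distrib add_divide_distrib)

lemma emp_mean_diff: "emp_mean N y (\<lambda>t. f t - g t) = emp_mean N y f - emp_mean N y g"
  by (simp add: emp_mean_def sum_subtractf diff_divide_distrib)

lemma emp_mean_nonneg: "(\<And>j. j < N \<Longrightarrow> 0 \<le> f (y j)) \<Longrightarrow> 0 \<le> emp_mean N y f"
  unfolding emp_mean_def by (intro divide_nonneg_nonneg sum_nonneg) auto

locale mercer_rkhs = rkhs k H ip
  for k :: "'a::t2_space \<Rightarrow> 'a \<Rightarrow> real" and H ip +
  fixes \<mu> :: "'a measure" and \<sigma> :: "nat \<Rightarrow> real" and e :: "nat \<Rightarrow> 'a \<Rightarrow> real"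
  assumes prob: "prob_space \<mu>" and sets_eq: "sets \<mu> = sets borel"
    and diag_integrable: "integrable \<mu> (\<lambda>x. k x x)"
    and L2: "L2_orthonormal \<mu> e" and \<sigma>_nonneg: "\<And>i. 0 \<le> \<sigma> i"
    and mercer: "mercer_decomposition k \<sigma> e"
    and basis: "orthonormal_basis H ip {i. \<sigma> i > 0} (\<lambda>i x. sqrt (\<sigma> i) * e i x)"
begin

sublocale prob_space \<mu> by (rule prob)

abbreviation "b i \<equiv> (\<lambda>x. sqrt (\<sigma> i) * e i x)"

section \<open>Consequences of the Mercer expansion\<close>

lemma measurable_cong_\<mu>: "f \<in> borel_measurable \<mu> \<longleftrightarrow> f \<in> borel_measurable borel"
  using measurable_cong_sets[OF sets_eq refl] by blast

lemma e_measurable [measurable]: "e i \<in> borel_measurable borel"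
  and e_square_integrable: "integrable \<mu> (\<lambda>x. (e i x)\<^sup>2)"
  and e_second: "(\<integral>x. (e i x)\<^sup>2 \<partial>\<mu>) = 1"
  using L2 unfolding L2_orthonormal_def measurable_cong_\<mu> by (auto simp: power2_eq_square)

lemma e_integrable: "integrable \<mu> (e i)"
  by (rule square_integrable_imp_integrable) (simp_all add: measurable_cong_\<mu> e_square_integrable)

lemma e_abs_integral: "(\<integral>x. \<bar>e i x\<bar> \<partial>\<mu>) \<le> 1"
  using expectation_sqrt_le(2)[OF e_square_integrable[of i]] by (simp add: e_second)

lemma e_mean_sq: "(\<integral>x. e i x \<partial>\<mu>)\<^sup>2 \<le> 1"
proof -
  have "\<bar>\<integral>x. e i x \<partial>\<mu>\<bar> \<le> 1"
    using integral_abs_bound[of \<mu> "e i"] e_abs_integral[of i] by linarith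
  then show ?thesis by (simp add: abs_square_le_1)
qed

lemma mercer_sums: "(\<lambda>i. \<sigma> i * e i x * e i y) sums k x y"
  using mercer by (simp add: mercer_decomposition_def)

lemma diag_sums: "(\<lambda>i. \<sigma> i * (e i x)\<^sup>2) sums k x x"
  using mercer_sums[of x x] by (simp add: power2_eq_square mult.assoc)

lemma k_measurable: "k x \<in> borel_measurable borel"
proof -
  have "k x = (\<lambda>y. \<Sum>i. \<sigma> i * e i x * e i y)"
    using mercer_sums by (auto simp: fun_eq_iff sums_iff)
  then show ?thesis by simp
qed

lemma diag_measurable: "(\<lambda>x. k x x) \<in> borel_measurable borel"
  using diag_integrable measurable_cong_\<mu> by blast

text \<open>Partial sums of the eigenvalues are integrals of partial diagonal Mercer sums, which
  stay below k(x,x).\<close>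

lemma \<sigma>_summable: "summable \<sigma>"
proof (rule bounded_imp_summable[OF \<sigma>_nonneg])
  fix n
  have "(\<Sum>i\<le>n. \<sigma> i) = (\<integral>x. (\<Sum>i\<le>n. \<sigma> i * (e i x)\<^sup>2) \<partial>\<mu>)"
    by (simp add: Bochner_Integration.integral_sum e_square_integrable e_second)
  also have "\<dots> \<le> (\<integral>x. k x x \<partial>\<mu>)"
  proof (rule integral_mono)
    fix x
    show "(\<Sum>i\<le>n. \<sigma> i * (e i x)\<^sup>2) \<le> k x x"
      using diag_sums[of x] \<sigma>_nonneg
      by (metis (no_types, lifting) finite_atMost mult_nonneg_nonneg sum_le_suminf sums_iff
          zero_le_power2)
  qed (simp_all add: e_square_integrable diag_integrable)
  finally show "(\<Sum>i\<le>n. \<sigma> i) \<le> (\<integral>x. k x x \<partial>\<mu>)" .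
qed

text \<open>The trace formula: the diagonal series has nonnegative terms and each squared
  \<open>e i\<close> has integral one.\<close>

lemma diag_integral: "(\<integral>x. k x x \<partial>\<mu>) = (\<Sum>i. \<sigma> i)"
proof -
  have "(\<integral>x. k x x \<partial>\<mu>) = (\<integral>x. (\<Sum>i. \<sigma> i * (e i x)\<^sup>2) \<partial>\<mu>)"
    using diag_sums by (simp add: sums_iff)
  also have "\<dots> = (\<Sum>i. \<integral>x. \<sigma> i * (e i x)\<^sup>2 \<partial>\<mu>)"
    using diag_sums \<sigma>_summable \<sigma>_nonneg
    by (intro integral_suminf) (auto simp: e_square_integrable e_second sums_iff abs_mult)
  finally show ?thesis by (simp add: e_second)
qed

text \<open>As indices start at 0, \<open>i + s\<close> runs over exactly the eigenvalues after the
  first \<open>s\<close>.\<close>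

lemma tail_integral: "(\<integral>x. k x x - (\<Sum>j<s. (b j x)\<^sup>2) \<partial>\<mu>) = (\<Sum>i. \<sigma> (i + s))"
proof -
  have "(\<integral>x. k x x - (\<Sum>j<s. (b j x)\<^sup>2) \<partial>\<mu>) = (\<Sum>i. \<sigma> i) - (\<Sum>j<s. \<sigma> j)"
    by (simp add: power_mult_distrib \<sigma>_nonneg diag_integrable e_square_integrable e_second
        Bochner_Integration.integral_sum diag_integral)
  then show ?thesis by (simp add: suminf_minus_initial_segment \<sigma>_summable)
qed

lemma tail_nonneg: "0 \<le> k x x - (\<Sum>j<s. (b j x)\<^sup>2)"
proof -
  have "(\<Sum>j<s. \<sigma> j * (e j x)\<^sup>2) \<le> k x x"
    using diag_sums[of x] \<sigma>_nonneg
    by (metis (no_types, lifting) finite_lessThan mult_nonneg_nonneg sum_le_suminf sums_iff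
        zero_le_power2)
  then show ?thesis by (simp add: power_mult_distrib \<sigma>_nonneg)
qed

text \<open>The factor 1 - m_i^2, with m_i the mean of \<open>e i\<close>, is the variance of
  \<open>e i\<close> under \<open>\<mu>\<close>. Both integrations are exchanged with the Mercer
  series; elementary square bounds reduce absolute convergence to the diagonal series and to the sum
  of the eigenvalues.\<close>

lemma kernel_const_eq: "kernel_const k \<mu> = (\<Sum>i. \<sigma> i * (1 - (\<integral>x. e i x \<partial>\<mu>)\<^sup>2))"
  and kernel_const_summable: "summable (\<lambda>i. \<sigma> i * (1 - (\<integral>x. e i x \<partial>\<mu>)\<^sup>2))"
proof -
  let ?m = "\<lambda>i. \<integral>x. e i x \<partial>\<mu>"
  \<comment> \<open>The factor \<open>c\<close> will be the L^1 norm or the absolute mean of an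
    eigenfunction, both at most one.\<close>
  have abs_le: "\<sigma> i * \<bar>a\<bar> * c \<le> \<sigma> i + \<sigma> i * a\<^sup>2" if "0 \<le> c" "c \<le> 1" for i a c
  proof -
    have "\<bar>a\<bar> * c \<le> \<bar>a\<bar>" using that by (intro mult_left_le) auto
    also have "\<bar>a\<bar> \<le> 1 + a\<^sup>2"
    proof -
      have "2 * \<bar>a\<bar> \<le> 1 + a\<^sup>2" using sum_squares_bound[of 1 "\<bar>a\<bar>"] by simp
      then show ?thesis by linarith
    qed
    finally have "\<sigma> i * (\<bar>a\<bar> * c) \<le> \<sigma> i * (1 + a\<^sup>2)"
      using \<sigma>_nonneg by (intro mult_left_mono)
    then show ?thesis by (simp add: algebra_simps)
  qed
  have summable_abs: "summable (\<lambda>i. \<sigma> i * \<bar>e i x\<bar> * c i)" if c: "\<And>i. 0 \<le> c i \<and> c i \<le> 1" for x c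
  proof (rule summable_comparison_test)
    show "summable (\<lambda>i. \<sigma> i + \<sigma> i * (e i x)\<^sup>2)"
      using \<sigma>_summable diag_sums[of x] by (intro summable_add) (auto simp: sums_iff)
    show "\<exists>N. \<forall>n\<ge>N. norm (\<sigma> n * \<bar>e n x\<bar> * c n) \<le> \<sigma> n + \<sigma> n * (e n x)\<^sup>2"
      using abs_le[of "c _"] c \<sigma>_nonneg by (simp add: abs_mult)
  qed
  have summable_\<sigma>m: "summable (\<lambda>i. \<sigma> i * c i)" if "\<And>i. \<bar>c i\<bar> \<le> 1" for c
    by (rule summable_comparison_test[OF _ \<sigma>_summable])
      (use that \<sigma>_nonneg in \<open>auto simp: abs_mult intro!: exI[of _ 0] mult_left_le\<close>)
  have m: "\<bar>?m i\<bar> \<le> 1" for i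
    using e_mean_sq[of i] by (simp add: abs_square_le_1)
  have inner: "(\<integral>y. k x y \<partial>\<mu>) = (\<Sum>i. \<sigma> i * e i x * ?m i)" for x
  proof -
    have "(\<integral>y. k x y \<partial>\<mu>) = (\<integral>y. (\<Sum>i. \<sigma> i * e i x * e i y) \<partial>\<mu>)"
      using mercer_sums by (simp add: sums_iff)
    also have "\<dots> = (\<Sum>i. \<integral>y. \<sigma> i * e i x * e i y \<partial>\<mu>)"
    proof (rule integral_suminf)
      show "AE y in \<mu>. summable (\<lambda>i. norm (\<sigma> i * e i x * e i y))"
      proof (rule AE_I2, rule summable_comparison_test)
        fix y
        show "summable (\<lambda>i. \<sigma> i * (e i x)\<^sup>2 + \<sigma> i * (e i y)\<^sup>2)"
          using diag_sums by (intro summable_add) (auto simp: sums_iff)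
        have "\<sigma> i * \<bar>e i x\<bar> * \<bar>e i y\<bar> \<le> \<sigma> i * (e i x)\<^sup>2 + \<sigma> i * (e i y)\<^sup>2" for i
        proof -
          have "2 * (\<bar>e i x\<bar> * \<bar>e i y\<bar>) \<le> (e i x)\<^sup>2 + (e i y)\<^sup>2"
            using sum_squares_bound[of "\<bar>e i x\<bar>" "\<bar>e i y\<bar>"] by (simp add: mult.assoc)
          moreover have "0 \<le> \<bar>e i x\<bar> * \<bar>e i y\<bar>" by simp
          ultimately have "\<bar>e i x\<bar> * \<bar>e i y\<bar> \<le> (e i x)\<^sup>2 + (e i y)\<^sup>2" by linarith
          from mult_left_mono[OF this \<sigma>_nonneg[of i]] show ?thesis by (simp add: algebra_simps)
        qed
        then show "\<exists>N. \<forall>n\<ge>N. norm (norm (\<sigma> n * e n x * e n y)) \<le> \<sigma> n * (e n x)\<^sup>2 + \<sigma> n * (e n y)\<^sup>2"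
          using \<sigma>_nonneg by (simp add: abs_mult)
      qed
      show "summable (\<lambda>i. \<integral>y. norm (\<sigma> i * e i x * e i y) \<partial>\<mu>)"
        using summable_abs[of "\<lambda>i. \<integral>y. \<bar>e i y\<bar> \<partial>\<mu>" x] e_abs_integral \<sigma>_nonneg
        by (simp add: abs_mult)
    qed (simp add: e_integrable)
    finally show ?thesis by simp
  qed
  have "(\<integral>x. (\<integral>y. k x y \<partial>\<mu>) \<partial>\<mu>) = (\<integral>x. (\<Sum>i. \<sigma> i * e i x * ?m i) \<partial>\<mu>)"
    by (simp add: inner)
  also have "\<dots> = (\<Sum>i. \<integral>x. \<sigma> i * e i x * ?m i \<partial>\<mu>)"
  proof (rule integral_suminf)
    show "AE x in \<mu>. summable (\<lambda>i. norm (\<sigma> i * e i x * ?m i))"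
      using summable_abs[of "\<lambda>i. \<bar>?m i\<bar>"] m \<sigma>_nonneg by (simp add: abs_mult)
    have "summable (\<lambda>i. \<sigma> i * ((\<integral>x. \<bar>e i x\<bar> \<partial>\<mu>) * \<bar>?m i\<bar>))"
      using e_abs_integral m by (intro summable_\<sigma>m) (simp add: abs_mult mult_le_one)
    then show "summable (\<lambda>i. \<integral>x. norm (\<sigma> i * e i x * ?m i) \<partial>\<mu>)"
      using \<sigma>_nonneg by (simp add: abs_mult mult.assoc)
  qed (simp add: e_integrable)
  also have "\<dots> = (\<Sum>i. \<sigma> i * (?m i)\<^sup>2)" by (simp add: power2_eq_square mult.assoc)
  finally have double: "(\<integral>x. (\<integral>y. k x y \<partial>\<mu>) \<partial>\<mu>) = (\<Sum>i. \<sigma> i * (?m i)\<^sup>2)" .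
  have sm: "summable (\<lambda>i. \<sigma> i * (?m i)\<^sup>2)"
    using e_mean_sq by (intro summable_\<sigma>m) simp
  show "summable (\<lambda>i. \<sigma> i * (1 - (?m i)\<^sup>2))"
    using summable_diff[OF \<sigma>_summable sm] by (simp add: algebra_simps)
  show "kernel_const k \<mu> = (\<Sum>i. \<sigma> i * (1 - (?m i)\<^sup>2))"
    using suminf_diff[OF \<sigma>_summable sm]
    by (simp add: kernel_const_def diag_integral double algebra_simps)
qed

text \<open>By Mercer's theorem this is the squared maximum mean discrepancy of \<open>\<mu>\<close> and the
  empirical measure.\<close>

definition mmd_sq :: "nat \<Rightarrow> (nat \<Rightarrow> 'a) \<Rightarrow> real" where
  "mmd_sq N y = (\<Sum>i. \<sigma> i * (emp_mean N y (e i) - (\<integral>t. e i t \<partial>\<mu>))\<^sup>2)"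

lemma mmd_sq_summable: "summable (\<lambda>i. \<sigma> i * (emp_mean N y (e i) - (\<integral>t. e i t \<partial>\<mu>))\<^sup>2)"
proof (cases "N = 0")
  \<comment> \<open>Division by zero makes the empirical mean 0, so each term is an eigenvalue times
    a squared mean of at most one.\<close>
  case True
  show ?thesis
    by (rule summable_comparison_test[OF _ \<sigma>_summable])
      (use True e_mean_sq \<sigma>_nonneg in \<open>auto simp: emp_mean_def abs_mult intro!: exI[of _ 0] mult_left_le\<close>)
next
  case False
  show ?thesis
  proof (rule summable_comparison_test)
    show "summable (\<lambda>i. 2 * (\<Sum>j<N. \<sigma> i * (e i (y j))\<^sup>2) + 2 * \<sigma> i)"
      using diag_sums \<sigma>_summable
      by (intro summable_add summable_mult summable_sum) (auto simp: sums_iff)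
    \<comment> \<open>Cauchy-Schwarz against the constant 1, with the crude factor N <= N^2, bounds
      the squared empirical mean by a sum of finitely many values whose weighted series converge by
      the diagonal expansion.\<close>
    have "(emp_mean N y (e i) - (\<integral>t. e i t \<partial>\<mu>))\<^sup>2 \<le> 2 * (\<Sum>j<N. (e i (y j))\<^sup>2) + 2" for i
    proof -
      have "(\<Sum>j<N. e i (y j))\<^sup>2 \<le> real N * (\<Sum>j<N. (e i (y j))\<^sup>2)"
        using Cauchy_Schwarz_ineq_sum[of "\<lambda>_. 1" "\<lambda>j. e i (y j)" "{..<N}"] by simp
      also have "\<dots> \<le> (real N)\<^sup>2 * (\<Sum>j<N. (e i (y j))\<^sup>2)"
        using False by (intro mult_right_mono sum_nonneg) (auto simp: power2_eq_square)
      finally have "(emp_mean N y (e i))\<^sup>2 \<le> (\<Sum>j<N. (e i (y j))\<^sup>2)"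
        using False by (simp add: emp_mean_def power_divide field_simps)
      moreover have "(p - q)\<^sup>2 \<le> 2 * p\<^sup>2 + 2 * q\<^sup>2" for p q :: real
        using zero_le_power2[of "p + q"] by (simp add: power2_eq_square algebra_simps)
      ultimately show ?thesis using e_mean_sq[of i] by (smt (verit))
    qed
    from mult_left_mono[OF this \<sigma>_nonneg]
    show "\<exists>M. \<forall>n\<ge>M. norm (\<sigma> n * (emp_mean N y (e n) - (\<integral>t. e n t \<partial>\<mu>))\<^sup>2)
        \<le> 2 * (\<Sum>j<N. \<sigma> n * (e n (y j))\<^sup>2) + 2 * \<sigma> n"
      using \<sigma>_nonneg by (simp add: abs_mult sum_distrib_left algebra_simps)
  qed
qed

lemma mmd_sq_nonneg: "0 \<le> mmd_sq N y"
  unfolding mmd_sq_def using \<sigma>_nonneg by (intro suminf_nonneg mmd_sq_summable) auto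

section \<open>Approximation by the Mercer basis and the discrepancy bound\<close>

lemma basis_approx:
  assumes "f \<in> H" "0 < \<epsilon>"
  obtains I c where "finite I" "I \<subseteq> {i. 0 < \<sigma> i}"
    "ip_norm ip (\<lambda>x. f x - (\<Sum>i\<in>I. c i * b i x)) < \<epsilon>"
proof -
  have "\<forall>f\<in>H. \<forall>\<epsilon>>0. \<exists>I c. finite I \<and> I \<subseteq> {i. 0 < \<sigma> i} \<and>
      ip_norm ip (\<lambda>x. f x - (\<Sum>i\<in>I. c i * b i x)) < \<epsilon>"
    using basis unfolding orthonormal_basis_def by (elim conjE)
  from this[rule_format, OF assms] show ?thesis using that by blast
qed

lemma b_mem: "b i \<in> H"
proof (cases "\<sigma> i = 0")
  case True
  then show ?thesis by (simp add: zero_mem)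
next
  case False
  then show ?thesis using basis \<sigma>_nonneg[of i] by (auto simp: orthonormal_basis_def)
qed

lemma b_ip: "ip (b i) (b j) = (if i = j \<and> 0 < \<sigma> i then 1 else 0)"
proof (cases "0 < \<sigma> i \<and> 0 < \<sigma> j")
  case True
  then show ?thesis using basis by (auto simp: orthonormal_basis_def)
next
  case False
  then have "\<sigma> i = 0 \<or> \<sigma> j = 0" using \<sigma>_nonneg[of i] \<sigma>_nonneg[of j] by linarith
  then have "b i = (\<lambda>x. 0) \<or> b j = (\<lambda>x. 0)" by auto
  then have "ip (b i) (b j) = 0"
    using ip_zero_left[OF b_mem] ip_commute[OF b_mem b_mem] by metis
  then show ?thesis using False by auto
qed

text \<open>Finite basis combinations are measurable and approximate \<open>f\<close> in norm;
  \<open>eval_bound\<close> makes the convergence pointwise.\<close>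

lemma H_measurable:
  assumes "f \<in> H"
  shows "f \<in> borel_measurable borel"
proof -
  have "\<exists>g. g \<in> borel_measurable borel \<and> g \<in> H \<and> ip_norm ip (\<lambda>x. f x - g x) < 1 / real (Suc n)" for n
  proof -
    obtain I c where "finite I" and I: "ip_norm ip (\<lambda>x. f x - (\<Sum>i\<in>I. c i * b i x)) < 1 / real (Suc n)"
      by (rule basis_approx[OF assms, of "1 / real (Suc n)"]) simp
    moreover have "(\<lambda>x. \<Sum>i\<in>I. c i * b i x) \<in> H"
      using \<open>finite I\<close> b_mem by (intro sum_mem) auto
    moreover have "(\<lambda>x. \<Sum>i\<in>I. c i * b i x) \<in> borel_measurable borel"
      by measurable
    ultimately show ?thesis by blast
  qed
  then obtain g where g: "\<And>n. g n \<in> borel_measurable borel" "\<And>n. g n \<in> H"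
    and close: "\<And>n. ip_norm ip (\<lambda>x. f x - g n x) < 1 / real (Suc n)"
    by metis
  have "(\<lambda>n. g n x) \<longlonglongrightarrow> f x" for x
  proof -
    have bound: "norm (f x - g n x) \<le> 1 / real (Suc n) * sqrt (k x x)" for n
      unfolding real_norm_def using eval_bound[OF diff_mem[OF assms g(2)], of x n] close[of n]
      by (smt (verit) k_diag_nonneg mult_right_mono real_sqrt_ge_zero)
    have lim: "(\<lambda>n. 1 / real (Suc n) * sqrt (k x x)) \<longlonglongrightarrow> 0"
      by (intro tendsto_mult_left_zero) (use LIMSEQ_Suc[OF lim_1_over_n] in simp)
    have "(\<lambda>n. f x - g n x) \<longlonglongrightarrow> 0"
      using bound lim by (rule Lim_null_comparison[OF always_eventually[OF allI]])
    from tendsto_diff[OF tendsto_const this]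
    have "(\<lambda>n. f x - (f x - g n x)) \<longlonglongrightarrow> f x - 0" .
    then show ?thesis by simp
  qed
  then show ?thesis using g(1) by (rule borel_measurable_LIMSEQ_real)
qed

lemma sqrt_diag_integrable: "integrable \<mu> (\<lambda>x. sqrt (k x x))"
  by (rule expectation_sqrt_le(1)[OF diag_integrable k_diag_nonneg])

lemma H_integrable:
  assumes "f \<in> H"
  shows "integrable \<mu> f"
proof (rule Bochner_Integration.integrable_bound)
  show "integrable \<mu> (\<lambda>x. ip_norm ip f * sqrt (k x x))" using sqrt_diag_integrable by simp
  show "AE x in \<mu>. norm (f x) \<le> norm (ip_norm ip f * sqrt (k x x))"
    using eval_bound[OF assms] by (auto intro: order_trans[OF _ abs_ge_self])
qed (simp add: measurable_cong_\<mu> H_measurable assms)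

lemma ip_norm_triangle:
  assumes "f \<in> H" "g \<in> H"
  shows "ip_norm ip g \<le> ip_norm ip f + ip_norm ip (\<lambda>x. f x - g x)"
proof -
  let ?d = "\<lambda>x. f x - g x"
  have d: "?d \<in> H" using assms by (rule diff_mem)
  have "(ip_norm ip g)\<^sup>2 = ip f g - ip ?d g"
    using assms by (simp add: ip_norm_sq ip_diff_left)
  also have "\<dots> \<le> (ip_norm ip f + ip_norm ip ?d) * ip_norm ip g"
    using ip_Cauchy_Schwarz[OF assms] ip_Cauchy_Schwarz[OF d assms(2)]
    unfolding distrib_right by linarith
  finally show ?thesis
    using ip_norm_nonneg[OF assms(1)] ip_norm_nonneg[OF assms(2)] ip_norm_nonneg[OF d]
    by (cases "ip_norm ip g = 0") (auto simp: power2_eq_square)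
qed

text \<open>The basis property supplies finite combinations \<open>g\<close> close to
  \<open>f\<close>. On \<open>g\<close>, Cauchy-Schwarz in the coefficients gives the discrepancy
  times |g|; on the small remainder \<open>h\<close>, both means are controlled by sqrt(k(t,t)). The
  slack \<open>\<delta>\<close> absorbs what is left.\<close>

lemma mmd_bound:
  assumes f: "f \<in> H" "ip_norm ip f \<le> 1"
  shows "\<bar>emp_mean N y f - (\<integral>t. f t \<partial>\<mu>)\<bar> \<le> sqrt (mmd_sq N y)"
proof (rule field_le_epsilon)
  fix \<delta> :: real assume "0 < \<delta>"
  define D where "D = sqrt (mmd_sq N y)"
  define C where "C = emp_mean N y (\<lambda>t. sqrt (k t t)) + (\<integral>t. sqrt (k t t) \<partial>\<mu>)"
  have C: "0 \<le> C"
    unfolding C_def by (intro add_nonneg_nonneg emp_mean_nonneg integral_nonneg_AE) (auto simp: k_diag_nonneg)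
  have D: "0 \<le> D" unfolding D_def using mmd_sq_nonneg by simp
  \<comment> \<open>The total excess is epsilon (D + C); the added 1 keeps the denominator
    positive.\<close>
  define \<epsilon> where "\<epsilon> = \<delta> / (D + C + 1)"
  have "0 < \<epsilon>" using \<open>0 < \<delta>\<close> C D by (simp add: \<epsilon>_def)
  then obtain I c where I: "finite I" "I \<subseteq> {i. 0 < \<sigma> i}"
    and close: "ip_norm ip (\<lambda>x. f x - (\<Sum>i\<in>I. c i * b i x)) < \<epsilon>"
    using basis_approx[OF f(1)] by blast
  define g where "g = (\<lambda>x. \<Sum>i\<in>I. c i * b i x)"
  define h where "h = (\<lambda>x. f x - g x)"
  have g: "g \<in> H" unfolding g_def using I b_mem by (intro sum_mem) auto
  have h: "h \<in> H" unfolding h_def using f(1) g by (rule diff_mem)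
  have h_norm: "ip_norm ip h < \<epsilon>" using close by (simp add: h_def g_def)
  define d where "d i = emp_mean N y (e i) - (\<integral>t. e i t \<partial>\<mu>)" for i
  have g_norm: "(ip_norm ip g)\<^sup>2 = (\<Sum>i\<in>I. (c i)\<^sup>2)"
  proof -
    have "(ip_norm ip g)\<^sup>2 = ip g g" using g by (rule ip_norm_sq)
    also have "\<dots> = (\<Sum>i\<in>I. c i * ip (b i) g)"
      unfolding g_def using I b_mem g[unfolded g_def] by (intro ip_sum_left) auto
    also have "\<dots> = (\<Sum>i\<in>I. c i * (\<Sum>j\<in>I. c j * ip (b i) (b j)))"
      unfolding g_def using I b_mem by (intro sum.cong refl arg_cong2[where f="(*)"] ip_sum_right) auto
    also have "\<dots> = (\<Sum>i\<in>I. c i * c i)"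
    proof (intro sum.cong refl arg_cong2[where f="(*)"])
      fix i assume "i \<in> I"
      then have "(\<Sum>j\<in>I. c j * ip (b i) (b j)) = (\<Sum>j\<in>I. if j = i then c i else 0)"
        using I by (intro sum.cong) (auto simp: b_ip)
      with \<open>i \<in> I\<close> I show "(\<Sum>j\<in>I. c j * ip (b i) (b j)) = c i" by simp
    qed
    finally show ?thesis by (simp add: power2_eq_square)
  qed
  have emp_g: "emp_mean N y g - (\<integral>t. g t \<partial>\<mu>) = (\<Sum>i\<in>I. c i * (sqrt (\<sigma> i) * d i))"
  proof -
    have "emp_mean N y g = (\<Sum>i\<in>I. c i * (sqrt (\<sigma> i) * emp_mean N y (e i)))"
      unfolding g_def emp_mean_def sum_divide_distrib sum_distrib_left times_divide_eq_right
      by (subst sum.swap) simp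
    moreover have "(\<integral>t. g t \<partial>\<mu>) = (\<Sum>i\<in>I. c i * (sqrt (\<sigma> i) * (\<integral>t. e i t \<partial>\<mu>)))"
      unfolding g_def by (subst Bochner_Integration.integral_sum) (auto simp: e_integrable)
    ultimately show ?thesis by (simp add: d_def sum_subtractf right_diff_distrib)
  qed
  have "(\<Sum>i\<in>I. c i * (sqrt (\<sigma> i) * d i))\<^sup>2 \<le> (\<Sum>i\<in>I. (c i)\<^sup>2) * (\<Sum>i\<in>I. (sqrt (\<sigma> i) * d i)\<^sup>2)"
    by (rule Cauchy_Schwarz_ineq_sum)
  also have "\<dots> \<le> (ip_norm ip g)\<^sup>2 * mmd_sq N y"
  proof -
    have "(\<Sum>i\<in>I. (sqrt (\<sigma> i) * d i)\<^sup>2) = (\<Sum>i\<in>I. \<sigma> i * (d i)\<^sup>2)"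
      by (simp add: power_mult_distrib \<sigma>_nonneg)
    also have "\<dots> \<le> mmd_sq N y"
      unfolding mmd_sq_def d_def using I \<sigma>_nonneg by (intro sum_le_suminf mmd_sq_summable) auto
    finally show ?thesis unfolding g_norm by (intro mult_left_mono sum_nonneg) auto
  qed
  also have "\<dots> = (ip_norm ip g * D)\<^sup>2"
    by (simp add: D_def power_mult_distrib mmd_sq_nonneg)
  finally have "\<bar>emp_mean N y g - (\<integral>t. g t \<partial>\<mu>)\<bar> \<le> ip_norm ip g * D"
    unfolding emp_g using D g by (simp add: abs_le_square_iff[symmetric] ip_norm_nonneg)
  also have "\<dots> \<le> (1 + \<epsilon>) * D"
    using ip_norm_triangle[OF f(1) g] f(2) h_norm D by (intro mult_right_mono) (auto simp: h_def)
  finally have g_err: "\<bar>emp_mean N y g - (\<integral>t. g t \<partial>\<mu>)\<bar> \<le> (1 + \<epsilon>) * D" .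
  have h_le: "\<bar>h t\<bar> \<le> \<epsilon> * sqrt (k t t)" for t
    using eval_bound[OF h, of t] h_norm
    by (smt (verit) k_diag_nonneg mult_right_mono real_sqrt_ge_zero)
  have "\<bar>emp_mean N y h\<bar> \<le> emp_mean N y (\<lambda>t. \<epsilon> * sqrt (k t t))"
    unfolding emp_mean_def abs_divide using h_le
    by (simp, intro divide_right_mono order_trans[OF sum_abs] sum_mono) auto
  moreover have "\<bar>\<integral>t. h t \<partial>\<mu>\<bar> \<le> (\<integral>t. \<epsilon> * sqrt (k t t) \<partial>\<mu>)"
    using h_le H_integrable[OF h] sqrt_diag_integrable
    by (intro order_trans[OF integral_abs_bound] integral_mono) auto
  moreover have "emp_mean N y (\<lambda>t. \<epsilon> * sqrt (k t t)) = \<epsilon> * emp_mean N y (\<lambda>t. sqrt (k t t))"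
    by (simp add: emp_mean_def sum_distrib_left)
  ultimately have h_err: "\<bar>emp_mean N y h - (\<integral>t. h t \<partial>\<mu>)\<bar> \<le> \<epsilon> * C"
    by (simp add: C_def distrib_left)
  have "emp_mean N y h = emp_mean N y f - emp_mean N y g"
    unfolding h_def by (rule emp_mean_diff)
  moreover have "(\<integral>t. h t \<partial>\<mu>) = (\<integral>t. f t \<partial>\<mu>) - (\<integral>t. g t \<partial>\<mu>)"
    unfolding h_def using H_integrable f(1) g by simp
  ultimately have "\<bar>emp_mean N y f - (\<integral>t. f t \<partial>\<mu>)\<bar> \<le> (1 + \<epsilon>) * D + \<epsilon> * C"
    using g_err h_err by linarith
  also have "\<dots> \<le> D + \<epsilon> * (D + C + 1)" using \<open>0 < \<epsilon>\<close> by (simp add: algebra_simps)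
  also have "\<dots> = D + \<delta>" using C D by (simp add: \<epsilon>_def)
  finally show "\<bar>emp_mean N y f - (\<integral>t. f t \<partial>\<mu>)\<bar> \<le> sqrt (mmd_sq N y) + \<delta>"
    by (simp add: D_def)
qed

end

section \<open>The worst-case error\<close>

lemma (in rkhs) nystrom_measurable:
  assumes "\<And>x. k x \<in> borel_measurable M"
  shows "(\<lambda>t. nystrom k Z t t) \<in> borel_measurable M"
proof -
  note [measurable] = assms
  show ?thesis
    unfolding nystrom_def inner_vec_def matrix_vector_mult_def kvec_def by simp
qed

lemma (in trunc_system) quad_error_split:
  assumes "KQuad k s (\<lambda>i. \<kappa> $ ix i) (trunc_fun k Z A V) N y w x"
    and good: "\<And>j. j < N \<Longrightarrow> good (y j)" and "s \<le> CARD('l)"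
    and "f \<in> H" "ip_norm ip f \<le> 1"
  shows "\<bar>quad (s + 1) w x f - emp_mean N y f\<bar>
    \<le> 2 * emp_mean N y (\<lambda>t. sqrt (k t t - nystrom k Z t t))
      + 2 * emp_mean N y (\<lambda>t. sqrt (\<Sum>m\<in>- ix ` {..<s}. \<kappa> $ m * (F m t)\<^sup>2))"
proof -
  have "emp_mean N y (\<lambda>t. sqrt (k t t - (\<Sum>m\<in>ix ` {..<s}. \<kappa> $ m * (F m t)\<^sup>2)))
      \<le> emp_mean N y (\<lambda>t. sqrt (k t t - nystrom k Z t t)
          + sqrt (\<Sum>m\<in>- ix ` {..<s}. \<kappa> $ m * (F m t)\<^sup>2))"
    using good by (intro emp_mean_mono residual_split)
  with quad_error[OF assms] show ?thesis unfolding emp_mean_add by linarith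
qed

context mercer_rkhs
begin

section \<open>From the quadrature error to the worst-case error\<close>

lemma wce_bound:
  assumes "\<And>f. f \<in> H \<Longrightarrow> ip_norm ip f \<le> 1 \<Longrightarrow> \<bar>quad n w x f - emp_mean N y f\<bar> \<le> B"
  shows "wce H ip \<mu> n w x \<le> ennreal (B + sqrt (mmd_sq N y))"
  unfolding wce_def
proof (rule SUP_least)
  fix f assume "f \<in> {f \<in> H. ip_norm ip f \<le> 1}"
  then have "\<bar>quad n w x f - (\<integral>t. f t \<partial>\<mu>)\<bar> \<le> B + sqrt (mmd_sq N y)"
    using assms[of f] mmd_bound[of f N y] by auto
  then show "ennreal \<bar>quad n w x f - (\<integral>t. f t \<partial>\<mu>)\<bar> \<le> ennreal (B + sqrt (mmd_sq N y))"
    by (rule ennreal_leI)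
qed

text \<open>By the diagonal expansion this is the Mercer remainder, the sum of sigma_i e_i(t)^2 over
  i >= s.\<close>

definition tail :: "nat \<Rightarrow> 'a \<Rightarrow> real" where
  "tail s t = k t t - (\<Sum>j<s. (b j t)\<^sup>2)"

lemma tail_measurable: "tail s \<in> borel_measurable borel"
  unfolding tail_def[abs_def] using diag_measurable by measurable

lemma tail_integrable: "integrable \<mu> (tail s)"
  unfolding tail_def[abs_def]
  by (intro Bochner_Integration.integrable_diff diag_integrable Bochner_Integration.integrable_sum)
    (simp add: power_mult_distrib e_square_integrable)

text \<open>\<open>tail_bound\<close> uses the orthogonality of the Mercer functions in
  \<open>H\<close>, so it also applies to the empirical measure, under which they are in general not
  orthogonal in L^2.\<close>

lemma trunc_tail_bound:
  fixes Z :: "'l::{finite,linorder} \<Rightarrow> 'a"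
  assumes "trunc_system k H ip \<nu> Z A V \<kappa>" "s \<le> CARD('l)"
  shows "(\<integral>t. (\<Sum>m\<in>- ix ` {..<s}. \<kappa> $ m * (trunc_system.F k Z A V m t)\<^sup>2) \<partial>\<nu>) \<le> (\<integral>t. tail s t \<partial>\<nu>)"
  unfolding tail_def using assms
  by (intro trunc_system.tail_bound[OF assms(1)]) (auto simp: b_mem b_ip)

text \<open>The sample is fixed here, and Jensen is applied under its empirical measure. The
  resulting bound contains none of \<open>A\<close>, \<open>V\<close>, \<open>\<kappa>\<close>, so
  it is a measurable function of the sample however these are chosen.\<close>

lemma wce_bound_empirical:
  fixes Z :: "'l::{finite,linorder} \<Rightarrow> 'a"
  assumes "trunc_decomp k (empirical_measure N y) Z A V \<kappa>"
    and KQ: "KQuad k s (\<lambda>i. \<kappa> $ ix i) (trunc_fun k Z A V) N y w x"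
    and s: "s \<le> CARD('l)" and "0 < N"
  shows "wce H ip \<mu> (s + 1) w x \<le> ennreal (2 * emp_mean N y (\<lambda>t. sqrt (k t t - nystrom k Z t t))
    + 2 * sqrt (emp_mean N y (tail s)) + sqrt (mmd_sq N y))"
proof (rule wce_bound)
  fix f assume f: "f \<in> H" "ip_norm ip f \<le> 1"
  interpret E: prob_space "empirical_measure N y"
    using \<open>0 < N\<close> by (rule prob_space_empirical)
  interpret T: trunc_system k H ip "empirical_measure N y" Z A V \<kappa>
    using assms(1) by unfold_locales
      (auto simp: k_measurable empirical_measure_def[THEN arg_cong[where f=sets]]
        integrable_empirical diag_measurable)
  let ?h = "\<lambda>t. \<Sum>m\<in>- ix ` {..<s}. \<kappa> $ m * (T.F m t)\<^sup>2"
  have h: "?h \<in> borel_measurable borel" "\<And>t. 0 \<le> ?h t"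
    using T.F_measurable T.\<kappa>_nonneg by (auto intro!: sum_nonneg)
  have "emp_mean N y (\<lambda>t. sqrt (?h t)) \<le> sqrt (emp_mean N y ?h)"
    using E.expectation_sqrt_le(2)[OF integrable_empirical[OF h(1)] h(2)] h(1)
    by (simp add: integral_empirical)
  also have "emp_mean N y ?h \<le> emp_mean N y (tail s)"
    using trunc_tail_bound[OF T.trunc_system_axioms s] h(1)
    by (simp add: integral_empirical tail_measurable)
  finally have "emp_mean N y (\<lambda>t. sqrt (?h t)) \<le> sqrt (emp_mean N y (tail s))" by simp
  then show "\<bar>quad (s + 1) w x f - emp_mean N y f\<bar>
      \<le> 2 * emp_mean N y (\<lambda>t. sqrt (k t t - nystrom k Z t t)) + 2 * sqrt (emp_mean N y (tail s))"
    using T.quad_error_split[OF KQ AE_empirical[OF T.AE_good] s f] by linarith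
qed

end

locale mercer_sample = mercer_rkhs k H ip \<mu> \<sigma> e + M: prob_space M
  for k :: "'a::t2_space \<Rightarrow> 'a \<Rightarrow> real" and H ip \<mu> \<sigma> e and M :: "'w measure" +
  fixes Y :: "nat \<Rightarrow> 'w \<Rightarrow> 'a" and N :: nat
  assumes N: "0 < N" and indep: "M.indep_vars (\<lambda>_. borel) Y {..<N}"
    and distr_Y: "\<And>j. j < N \<Longrightarrow> distr M borel (Y j) = \<mu>"
begin

abbreviation "sample \<omega> \<equiv> (\<lambda>j. Y j \<omega>)"

section \<open>Expectations over the draws of the sample\<close>

lemma Y_measurable: "j < N \<Longrightarrow> Y j \<in> measurable M borel"
  using indep unfolding M.indep_vars_def by auto

lemma integral_Y:
  fixes f :: "'a \<Rightarrow> real"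
  assumes "j < N" "f \<in> borel_measurable borel"
  shows "(\<integral>\<omega>. f (Y j \<omega>) \<partial>M) = (\<integral>t. f t \<partial>\<mu>)"
    and "integrable M (\<lambda>\<omega>. f (Y j \<omega>)) \<longleftrightarrow> integrable \<mu> f"
  using integral_distr[OF Y_measurable[OF assms(1)] assms(2)]
    integrable_distr_eq[OF Y_measurable[OF assms(1)] assms(2)] distr_Y[OF assms(1)] by simp_all

lemma emp_mean_expectation:
  assumes "f \<in> borel_measurable borel" "integrable \<mu> f"
  shows "integrable M (\<lambda>\<omega>. emp_mean N (sample \<omega>) f)"
    and "(\<integral>\<omega>. emp_mean N (sample \<omega>) f \<partial>M) = (\<integral>t. f t \<partial>\<mu>)"
proof -
  have int: "integrable M (\<lambda>\<omega>. f (Y j \<omega>))" if "j < N" for j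
    using integral_Y(2)[OF that assms(1)] assms(2) by simp
  then show "integrable M (\<lambda>\<omega>. emp_mean N (sample \<omega>) f)"
    unfolding emp_mean_def
    by (intro Bochner_Integration.integrable_divide Bochner_Integration.integrable_sum) auto
  have "(\<integral>\<omega>. (\<Sum>j<N. f (Y j \<omega>)) \<partial>M) = (\<Sum>j<N. \<integral>t. f t \<partial>\<mu>)"
    using int integral_Y(1)[OF _ assms(1)] by (subst Bochner_Integration.integral_sum) auto
  then show "(\<integral>\<omega>. emp_mean N (sample \<omega>) f \<partial>M) = (\<integral>t. f t \<partial>\<mu>)"
    unfolding emp_mean_def using N by simp
qed

text \<open>Each squared deviation has expectation Var(e_i) / N, and summing with weights
  \<open>\<sigma> i\<close> gives the series for the kernel constant. All terms are nonnegative, so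
  summability of their expectations permits the exchange.\<close>

lemma mmd_sq_expectation:
  shows "integrable M (\<lambda>\<omega>. mmd_sq N (sample \<omega>))"
    and "(\<integral>\<omega>. mmd_sq N (sample \<omega>) \<partial>M) = kernel_const k \<mu> / real N"
proof -
  define m where "m i = (\<integral>t. e i t \<partial>\<mu>)" for i
  define D where "D i \<omega> = (emp_mean N (sample \<omega>) (e i) - m i)\<^sup>2" for i \<omega>
  have D: "integrable M (D i)" "(\<integral>\<omega>. D i \<omega> \<partial>M) = (1 - (m i)\<^sup>2) / real N" for i
  proof -
    define X where "X j \<omega> = e i (Y j \<omega>) - m i" for j \<omega>
    have cm: "(\<lambda>t. e i t - m i) \<in> borel_measurable borel"
        "(\<lambda>t. (e i t - m i)\<^sup>2) \<in> borel_measurable borel" by auto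
    have int2: "integrable \<mu> (\<lambda>t. (e i t - m i)\<^sup>2)"
      by (simp add: power2_diff e_square_integrable e_integrable)
    have "M.indep_vars (\<lambda>_. borel) X {..<N}"
      unfolding X_def using M.indep_vars_compose2[OF indep, of "\<lambda>_ t. e i t - m i"] by simp
    moreover have "integrable M (\<lambda>\<omega>. (X j \<omega>)\<^sup>2)" if "j < N" for j
      unfolding X_def using integral_Y(2)[OF that cm(2)] int2 by simp
    moreover have "(\<integral>\<omega>. X j \<omega> \<partial>M) = 0" if "j < N" for j
      unfolding X_def using integral_Y(1)[OF that cm(1)] e_integrable[of i] prob_space
      by (simp add: m_def)
    moreover have "(\<integral>\<omega>. (X j \<omega>)\<^sup>2 \<partial>M) = 1 - (m i)\<^sup>2" if "j < N" for j
      unfolding X_def using integral_Y(1)[OF that cm(2)]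
        variance_eq[OF e_integrable e_square_integrable, of i]
      by (simp add: m_def e_second)
    moreover have "D i = (\<lambda>\<omega>. ((\<Sum>j<N. X j \<omega>) / real N)\<^sup>2)"
      using N by (simp add: fun_eq_iff D_def X_def emp_mean_def sum_subtractf diff_divide_distrib)
    ultimately show "integrable M (D i)" "(\<integral>\<omega>. D i \<omega> \<partial>M) = (1 - (m i)\<^sup>2) / real N"
      using M.sample_mean_second_moment[of X N "1 - (m i)\<^sup>2"] N by auto
  qed
  have eq: "mmd_sq N (sample \<omega>) = (\<Sum>i. \<sigma> i * D i \<omega>)" for \<omega>
    by (simp add: mmd_sq_def D_def m_def)
  have D_nonneg: "0 \<le> D i \<omega>" for i \<omega> by (simp add: D_def)
  have int: "integrable M (\<lambda>\<omega>. \<sigma> i * D i \<omega>)" for i using D(1) by simp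
  have ae: "AE \<omega> in M. summable (\<lambda>i. norm (\<sigma> i * D i \<omega>))"
    using mmd_sq_summable[of N "sample _"] \<sigma>_nonneg D_nonneg
    by (simp add: abs_mult) (simp add: D_def m_def)
  have val: "(\<integral>\<omega>. \<sigma> i * D i \<omega> \<partial>M) = \<sigma> i * (1 - (m i)\<^sup>2) / real N" for i
    using D by simp
  have norm_val: "(\<integral>\<omega>. norm (\<sigma> i * D i \<omega>) \<partial>M) = \<sigma> i * (1 - (m i)\<^sup>2) / real N" for i
    using val \<sigma>_nonneg D_nonneg by (simp add: abs_mult)
  have sm: "summable (\<lambda>i. \<integral>\<omega>. norm (\<sigma> i * D i \<omega>) \<partial>M)"
    unfolding norm_val m_def by (intro summable_divide kernel_const_summable)
  show "integrable M (\<lambda>\<omega>. mmd_sq N (sample \<omega>))"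
    unfolding eq by (rule integrable_suminf[OF int ae sm])
  have "(\<integral>\<omega>. mmd_sq N (sample \<omega>) \<partial>M) = (\<Sum>i. \<sigma> i * (1 - (m i)\<^sup>2) / real N)"
    unfolding eq integral_suminf[OF int ae sm] val ..
  also have "\<dots> = kernel_const k \<mu> / real N"
    unfolding kernel_const_eq m_def by (rule suminf_divide[OF kernel_const_summable])
  finally show "(\<integral>\<omega>. mmd_sq N (sample \<omega>) \<partial>M) = kernel_const k \<mu> / real N" .
qed

lemma nystrom_gap_integrable: "integrable \<mu> (\<lambda>t. sqrt (k t t - nystrom k Z t t))"
proof (rule Bochner_Integration.integrable_bound[OF sqrt_diag_integrable])
  show "(\<lambda>t. sqrt (k t t - nystrom k Z t t)) \<in> borel_measurable \<mu>"
    unfolding measurable_cong_\<mu>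
    using diag_measurable nystrom_measurable[OF k_measurable] by measurable
  show "AE t in \<mu>. norm (sqrt (k t t - nystrom k Z t t)) \<le> norm (sqrt (k t t))"
    using nystrom_nonneg[of Z] nystrom_le[of Z] k_diag_nonneg by (intro AE_I2) auto
qed

text \<open>The final averaging shared by both kernels; \<open>B\<close> is the truncation term,
  which differs between them. The discrepancy term is handled by Jensen over the draws.\<close>

lemma expected_bound:
  assumes "AE \<omega> in M. R \<omega> \<le> ennreal (2 * emp_mean N (sample \<omega>) (\<lambda>t. sqrt (k t t - nystrom k Z t t))
      + 2 * B \<omega> + sqrt (mmd_sq N (sample \<omega>)))"
    and B: "integrable M B" "\<And>\<omega>. 0 \<le> B \<omega>" "(\<integral>\<omega>. B \<omega> \<partial>M) \<le> sqrt (\<Sum>i. \<sigma> (i + s))"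
  shows "(\<integral>\<^sup>+\<omega>. R \<omega> \<partial>M) \<le> ennreal (2 * (\<integral>t. sqrt (k t t - nystrom k Z t t) \<partial>\<mu>)
      + 2 * sqrt (\<Sum>i. \<sigma> (i + s)) + sqrt (kernel_const k \<mu> / real N))"
proof -
  let ?\<phi> = "\<lambda>t. sqrt (k t t - nystrom k Z t t)"
  let ?bound = "\<lambda>\<omega>. 2 * emp_mean N (sample \<omega>) ?\<phi> + 2 * B \<omega> + sqrt (mmd_sq N (sample \<omega>))"
  have "?\<phi> \<in> borel_measurable borel"
    using nystrom_gap_integrable measurable_cong_\<mu> by blast
  note \<phi> = emp_mean_expectation[OF this nystrom_gap_integrable]
  note mmd = M.expectation_sqrt_le[OF mmd_sq_expectation(1) mmd_sq_nonneg]
  have "(\<integral>\<^sup>+\<omega>. R \<omega> \<partial>M) \<le> (\<integral>\<^sup>+\<omega>. ennreal (?bound \<omega>) \<partial>M)"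
    using assms(1) by (rule nn_integral_mono_AE)
  also have "\<dots> = ennreal (\<integral>\<omega>. ?bound \<omega> \<partial>M)"
    using \<phi>(1) mmd(1) B nystrom_le mmd_sq_nonneg
    by (intro nn_integral_eq_integral AE_I2 add_nonneg_nonneg mult_nonneg_nonneg emp_mean_nonneg) auto
  also have "(\<integral>\<omega>. ?bound \<omega> \<partial>M)
      = 2 * (\<integral>t. ?\<phi> t \<partial>\<mu>) + 2 * (\<integral>\<omega>. B \<omega> \<partial>M) + (\<integral>\<omega>. sqrt (mmd_sq N (sample \<omega>)) \<partial>M)"
    using \<phi> mmd(1) B(1) by simp
  also have "ennreal \<dots> \<le> ennreal (2 * (\<integral>t. ?\<phi> t \<partial>\<mu>)
      + 2 * sqrt (\<Sum>i. \<sigma> (i + s)) + sqrt (kernel_const k \<mu> / real N))"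
    using mmd(2) B(3) unfolding mmd_sq_expectation(2) by (intro ennreal_leI) linarith
  finally show ?thesis .
qed

text \<open>The truncation term is the square root of the sample mean of the Mercer tail. A second
  Jensen step, now over the draws, moves the expectation inside, where it becomes the sum of the
  eigenvalues after the first \<open>s\<close>.\<close>

lemma expected_wce_empirical:
  fixes Z :: "'l::{finite,linorder} \<Rightarrow> 'a"
  assumes s: "s \<le> CARD('l)"
    and "AE \<omega> in M. trunc_decomp k (empirical_measure N (sample \<omega>)) Z (A \<omega>) (V \<omega>) (\<kappa> \<omega>) \<and>
      KQuad k s (\<lambda>i. \<kappa> \<omega> $ ix i) (trunc_fun k Z (A \<omega>) (V \<omega>)) N (sample \<omega>) (w \<omega>) (x \<omega>)"
  shows "(\<integral>\<^sup>+\<omega>. wce H ip \<mu> (s + 1) (w \<omega>) (x \<omega>) \<partial>M)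
    \<le> ennreal (2 * (\<integral>t. sqrt (k t t - nystrom k Z t t) \<partial>\<mu>)
      + 2 * sqrt (\<Sum>i. \<sigma> (i + s)) + sqrt (kernel_const k \<mu> / real N))"
proof (rule expected_bound)
  show "AE \<omega> in M. wce H ip \<mu> (s + 1) (w \<omega>) (x \<omega>)
      \<le> ennreal (2 * emp_mean N (sample \<omega>) (\<lambda>t. sqrt (k t t - nystrom k Z t t))
        + 2 * sqrt (emp_mean N (sample \<omega>) (tail s)) + sqrt (mmd_sq N (sample \<omega>)))"
    using assms(2)
  proof eventually_elim
    case (elim \<omega>)
    then show ?case using wce_bound_empirical[OF _ _ s N] by blast
  qed
  note tail = emp_mean_expectation[OF tail_measurable tail_integrable, of s]
  have nonneg: "0 \<le> emp_mean N (sample \<omega>) (tail s)" for \<omega>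
    using tail_nonneg by (intro emp_mean_nonneg) (simp add: tail_def)
  then show "0 \<le> sqrt (emp_mean N (sample \<omega>) (tail s))" for \<omega> by simp
  show "integrable M (\<lambda>\<omega>. sqrt (emp_mean N (sample \<omega>) (tail s)))"
    using tail(1) nonneg by (rule M.expectation_sqrt_le(1))
  show "(\<integral>\<omega>. sqrt (emp_mean N (sample \<omega>) (tail s)) \<partial>M) \<le> sqrt (\<Sum>i. \<sigma> (i + s))"
    using M.expectation_sqrt_le(2)[OF tail(1) nonneg]
    unfolding tail(2) unfolding tail_def tail_integral .
qed

text \<open>The kernel is fixed before sampling, so the sample mean of sqrt(k^Z - k_s) has its
  \<open>\<mu>\<close>-integral as expectation, and one Jensen step under \<open>\<mu>\<close>
  suffices.\<close>

lemma expected_wce_population: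
  fixes Z :: "'l::{finite,linorder} \<Rightarrow> 'a"
  assumes s: "s \<le> CARD('l)" and "trunc_decomp k \<mu> Z A V \<kappa>"
    and KQ: "AE \<omega> in M. KQuad k s (\<lambda>i. \<kappa> $ ix i) (trunc_fun k Z A V) N (sample \<omega>) (w \<omega>) (x \<omega>)"
  shows "(\<integral>\<^sup>+\<omega>. wce H ip \<mu> (s + 1) (w \<omega>) (x \<omega>) \<partial>M)
    \<le> ennreal (2 * (\<integral>t. sqrt (k t t - nystrom k Z t t) \<partial>\<mu>)
      + 2 * sqrt (\<Sum>i. \<sigma> (i + s)) + sqrt (kernel_const k \<mu> / real N))"
proof -
  interpret T: trunc_system k H ip \<mu> Z A V \<kappa>
    using assms(2) by unfold_locales (auto simp: k_measurable sets_eq diag_integrable)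
  let ?h = "\<lambda>t. \<Sum>m\<in>- ix ` {..<s}. \<kappa> $ m * (T.F m t)\<^sup>2"
  have h: "?h \<in> borel_measurable borel" "\<And>t. 0 \<le> ?h t"
    using T.F_measurable T.\<kappa>_nonneg by (auto intro!: sum_nonneg)
  have h_int: "integrable \<mu> ?h"
    by (intro Bochner_Integration.integrable_sum integrable_mult_right T.square_integrable
        T.F_mem T.F_measurable)
  note sqrt_h = expectation_sqrt_le[OF h_int h(2)]
  have "(\<lambda>t. sqrt (?h t)) \<in> borel_measurable borel" using h(1) by measurable
  note emp = emp_mean_expectation[OF this sqrt_h(1)]
  show ?thesis
  proof (rule expected_bound)
    \<comment> \<open>Each sample point has law \<open>\<mu>\<close> and is therefore almost surely
      good; only finitely many null sets are discarded.\<close>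
    have "AE \<omega> in M. T.good (Y j \<omega>)" if "j < N" for j
      using AE_distrD[OF Y_measurable[OF that], of T.good] T.AE_good
      by (simp only: distr_Y[OF that])
    then have "AE \<omega> in M. \<forall>j\<in>{..<N}. T.good (Y j \<omega>)"
      by (subst AE_finite_all) auto
    with KQ show "AE \<omega> in M. wce H ip \<mu> (s + 1) (w \<omega>) (x \<omega>)
        \<le> ennreal (2 * emp_mean N (sample \<omega>) (\<lambda>t. sqrt (k t t - nystrom k Z t t))
          + 2 * emp_mean N (sample \<omega>) (\<lambda>t. sqrt (?h t)) + sqrt (mmd_sq N (sample \<omega>)))"
    proof eventually_elim
      case (elim \<omega>)
      then show ?case by (intro wce_bound T.quad_error_split s) auto
    qed
    show "0 \<le> emp_mean N (sample \<omega>) (\<lambda>t. sqrt (?h t))" for \<omega>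
      using h(2) by (intro emp_mean_nonneg) simp
    show "integrable M (\<lambda>\<omega>. emp_mean N (sample \<omega>) (\<lambda>t. sqrt (?h t)))" by (rule emp(1))
    have "(\<integral>t. ?h t \<partial>\<mu>) \<le> (\<Sum>i. \<sigma> (i + s))"
      using trunc_tail_bound[OF T.trunc_system_axioms s] unfolding tail_def tail_integral .
    then show "(\<integral>\<omega>. emp_mean N (sample \<omega>) (\<lambda>t. sqrt (?h t)) \<partial>M) \<le> sqrt (\<Sum>i. \<sigma> (i + s))"
      unfolding emp(2) using sqrt_h(2) real_sqrt_le_mono order_trans by blast
  qed
qed

end

theorem theorem4:
  fixes \<mu> :: "'a::t2_space measure"
    and k :: "'a \<Rightarrow> 'a \<Rightarrow> real"
    and H :: "('a \<Rightarrow> real) set"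
    and ip :: "('a \<Rightarrow> real) \<Rightarrow> ('a \<Rightarrow> real) \<Rightarrow> real"
    and \<sigma> :: "nat \<Rightarrow> real" and e :: "nat \<Rightarrow> 'a \<Rightarrow> real"
    and Z :: "'l::{finite,linorder} \<Rightarrow> 'a"
    and s N :: nat
    and M :: "'w measure" and Y :: "nat \<Rightarrow> 'w \<Rightarrow> 'a"
  assumes "prob_space \<mu>" and "sets \<mu> = sets borel"
    and "pd_kernel k" and "integrable \<mu> (\<lambda>x. k x x)"
    and "rkhs k H ip"
    and "eigen_system k \<mu> \<sigma> e"
    and "mercer_decomposition k \<sigma> e"
    and "orthonormal_basis H ip {i. \<sigma> i > 0} (\<lambda>i x. sqrt (\<sigma> i) * e i x)"
    and "s \<le> CARD('l)" and "N > 0"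
    and "prob_space M"
    and "prob_space.indep_vars M (\<lambda>_. borel) Y {..<N}"
    and "\<And>j. j < N \<Longrightarrow> distr M borel (Y j) = \<mu>"
  shows
    "let bound = ennreal (2 * (\<integral>x. sqrt (k x x - nystrom k Z x x) \<partial>\<mu>)
                   + 2 * sqrt (\<Sum>i. \<sigma> (i + s))
                   + sqrt (kernel_const k \<mu> / real N));
         random_rule = (\<lambda>(W :: nat \<Rightarrow> 'w \<Rightarrow> real) (X :: nat \<Rightarrow> 'w \<Rightarrow> 'a).
                   \<forall>i<s + 1. W i \<in> borel_measurable M \<and> X i \<in> measurable M borel);
         expected_wce = (\<lambda>(W :: nat \<Rightarrow> 'w \<Rightarrow> real) (X :: nat \<Rightarrow> 'w \<Rightarrow> 'a).
                   \<integral>\<^sup>+\<omega>. wce H ip \<mu> (s + 1) (\<lambda>i. W i \<omega>) (\<lambda>i. X i \<omega>) \<partial>M)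
     in
       (\<forall>W X (A :: 'w \<Rightarrow> real^'l::_^'l::_) (V :: 'w \<Rightarrow> real^'l::_^'l::_) (\<kappa> :: 'w \<Rightarrow> real^'l::_).
          random_rule W X \<longrightarrow>
          (AE \<omega> in M.
             trunc_decomp k (empirical_measure N (\<lambda>j. Y j \<omega>)) Z (A \<omega>) (V \<omega>) (\<kappa> \<omega>) \<and>
             KQuad k s (\<lambda>i. \<kappa> \<omega> $ ix i) (trunc_fun k Z (A \<omega>) (V \<omega>))
               N (\<lambda>j. Y j \<omega>) (\<lambda>i. W i \<omega>) (\<lambda>i. X i \<omega>)) \<longrightarrow>
          expected_wce W X \<le> bound) \<and>
       (\<forall>W X (A :: real^'l::_^'l::_) (V :: real^'l::_^'l::_) (\<kappa> :: real^'l::_).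
          random_rule W X \<longrightarrow>
          trunc_decomp k \<mu> Z A V \<kappa> \<longrightarrow>
          (AE \<omega> in M.
             KQuad k s (\<lambda>i. \<kappa> $ ix i) (trunc_fun k Z A V)
               N (\<lambda>j. Y j \<omega>) (\<lambda>i. W i \<omega>) (\<lambda>i. X i \<omega>)) \<longrightarrow>
          expected_wce W X \<le> bound)"
proof -
  interpret mercer_sample k H ip \<mu> \<sigma> e M Y N
    using assms by (intro mercer_sample.intro mercer_rkhs.intro mercer_rkhs_axioms.intro
        mercer_sample_axioms.intro) (auto simp: eigen_system_def)
  show ?thesis
    unfolding Let_def
    by (intro conjI allI impI expected_wce_empirical expected_wce_population \<open>s \<le> CARD('l)\<close>;
        assumption)
qed

end
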